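(* Let $\Omega\subset\mathbb{R}^n$ be a convex domain with inradius $r$. Then, for any inner parallel set $\Omega_t$, $t\geq 0$, it holds that $$|\partial\Omega_t|\geq \Bigl(1-\frac{t}{r}\Bigr)_+^{n-1}|\partial\Omega|.$$ Further, equality holds for some $t\in(0,r)$ if and only if $\Omega$ is homothetic to its form body $\Omega_*$. If this is the case, equality holds for all $t\geq 0$.
   Context: Here "convex domain" means a convex body (compact convex set) in $\mathbb{R}^n$ with nonempty interior. Let $B$ be the closed unit ball and $\mathbb{S}^{n-1}$ the unit sphere of $\mathbb{R}^n$. For $t\geq 0$ the inner parallel set of $\Omega$ at distance $t$ is $\Omega_t=\{x\in\Omega:\operatorname{dist}(x,\Omega^c)\geq t\}$, equivalently the Minkowski difference $\{x\in\mathbb{R}^n: x+tB\subseteq\Omega\}$. The inradius $r$ of $\Omega$ is the radius of the largest ball contained in $\Omega$. $|\partial K|$ denotes the perimeter of $K$, i.e. the surface measure of its boundary. For real $x$, $x_+=(|x|+x)/2$, and $(x)_+^{n-1}$ means $(x_+)^{n-1}$. The support function of $\Omega$ is $h(\Omega,u)=\sup_{x\in\Omega}\langle x,u\rangle$. A point $x\in\partial\Omega$ is called regular if the supporting hyperplane of $\Omega$ at $x$ is uniquely defined, i.e. there is a unique $u\in\mathbb{S}^{n-1}$ with $\langle x,u\rangle=h(\Omega,u)$. Let $\mathcal{U}(\Omega)\subseteq\mathbb{S}^{n-1}$ be the set of all outward pointing unit normals to $\partial\Omega$ at regular points. The form body of $\Omega$ is $$\Omega_*=\bigcap_{u\in\mathcal{U}(\Omega)}\{x\in\mathbb{R}^n:\langle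 x,u\rangle\leq 1\}.$$ $\Omega$ is homothetic to $\Omega_*$ if $\Omega=x_0+\lambda\Omega_*$ for some $x_0\in\mathbb{R}^n$ and $\lambda>0$.
   Formalization: The dimension is assumed to be n ≥ 2; for n = 1 the claim fails for every interval (at t = r or t > r, depending on the convention for 0^0). *)

theory Defs
  imports "HOL-Analysis.Analysis"
begin

definition convex_domain :: "'a::euclidean_space set \<Rightarrow> bool" where
  "convex_domain \<Omega> \<longleftrightarrow> compact \<Omega> \<and> convex \<Omega> \<and> interior \<Omega> \<noteq> {}"

(* Hausdorff measure of integer dimension k, built from countable covers by sets of small
   diameter.  The factor unit_ball_vol k / 2 ^ k is the standard normalisation, under which
   k-dimensional Hausdorff measure is k-dimensional area.  The empty set gets weight 0
   explicitly because 0 ^ 0 = 1 (this only matters for k = 0); boundedness is required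
   because diameter has no meaningful value on unbounded sets. *)

definition hausdorff_weight :: "nat \<Rightarrow> 'a::metric_space set \<Rightarrow> ennreal" where
  "hausdorff_weight k U =
     (if U = {} then 0 else ennreal (unit_ball_vol (real k) / 2 ^ k * diameter U ^ k))"

definition hausdorff_content :: "nat \<Rightarrow> real \<Rightarrow> 'a::metric_space set \<Rightarrow> ennreal" where
  "hausdorff_content k \<delta> E =
     (INF U \<in> {U :: nat \<Rightarrow> 'a set. E \<subseteq> (\<Union>i. U i) \<and> (\<forall>i. bounded (U i) \<and> diameter (U i) \<le> \<delta>)}.
        \<Sum>i. hausdorff_weight k (U i))"

definition hausdorff_measure :: "nat \<Rightarrow> 'a::metric_space set \<Rightarrow> ennreal" where
  "hausdorff_measure k E = (SUP \<delta> \<in> {0<..}. hausdorff_content k \<delta> E)"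

definition perimeter :: "'a::euclidean_space set \<Rightarrow> ennreal" where
  "perimeter K = hausdorff_measure (DIM('a) - 1) (frontier K)"

definition inner_parallel :: "'a::euclidean_space set \<Rightarrow> real \<Rightarrow> 'a set" where
  "inner_parallel \<Omega> t = {x \<in> \<Omega>. infdist x (- \<Omega>) \<ge> t}"

definition inradius :: "'a::euclidean_space set \<Rightarrow> real" where
  "inradius \<Omega> = Sup {\<rho>. 0 \<le> \<rho> \<and> (\<exists>x. cball x \<rho> \<subseteq> \<Omega>)}"

definition support_function :: "'a::euclidean_space set \<Rightarrow> 'a \<Rightarrow> real" where
  "support_function \<Omega> u = (SUP x\<in>\<Omega>. x \<bullet> u)"

definition regular_point :: "'a::euclidean_space set \<Rightarrow> 'a \<Rightarrow> bool" where
  "regular_point \<Omega> x \<longleftrightarrow>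
     x \<in> frontier \<Omega> \<and> (\<exists>!u. u \<in> sphere 0 1 \<and> x \<bullet> u = support_function \<Omega> u)"

definition regular_normals :: "'a::euclidean_space set \<Rightarrow> 'a set" where
  "regular_normals \<Omega> =
     {u \<in> sphere 0 1. \<exists>x. regular_point \<Omega> x \<and> x \<bullet> u = support_function \<Omega> u}"

definition form_body :: "'a::euclidean_space set \<Rightarrow> 'a set" where
  "form_body \<Omega> = (\<Inter>u\<in>regular_normals \<Omega>. {x. x \<bullet> u \<le> 1})"

definition homothetic_to :: "'a::euclidean_space set \<Rightarrow> 'a set \<Rightarrow> bool" where
  "homothetic_to K L \<longleftrightarrow> (\<exists>x0 l. l > 0 \<and> K = (\<lambda>x. x0 + l *\<^sub>R x) ` L)"

definition pos_part :: "real \<Rightarrow> real" where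
  "pos_part x = (\<bar>x\<bar> + x) / 2"

end

theory Submission
  imports Defs
begin

text \<open>
  For the inequality, let \<open>cball x0 r\<close> be an inball of \<open>\<Omega>\<close> and \<open>0 < t < r\<close>. The homothetic copy of \<open>\<Omega>\<close>
  with centre \<open>x0\<close> and ratio \<open>1 - t / r\<close> lies in the inner parallel set
  (\<open>homothet_image_subset_inner_parallel\<close>). Perimeter is monotone on convex bodies, because the
  nearest-point map to the smaller body is 1-Lipschitz and maps the larger boundary onto the smaller
  one (\<open>perimeter_mono\<close>), and it scales with the power \<open>n - 1\<close>.

  In the equality case, use that perimeter is even strictly monotone (\<open>perimeter_strict_mono\<close>):
  equality for one \<open>t\<close> in the open interval from \<open>0\<close> to \<open>r\<close> means that the inner parallel set equals
  the homothetic copy. Every supporting hyperplane at a regular point of \<open>\<Omega>\<close> is then at distance \<open>r\<close>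
  from \<open>x0\<close> (\<open>support_function_if_inner_parallel_homothet\<close>). A convex body is the intersection of its
  supporting half-spaces at regular points (\<open>convex_domain_eq_regular_halfspaces\<close>), so
  \<open>\<Omega>\<close> is the image of its form body under \<open>x \<mapsto> x0 + r x\<close>.

  Conversely, if \<open>\<Omega>\<close> is homothetic to its form body with ratio \<open>l\<close>, it is an intersection of
  half-spaces bounded by hyperplanes at distance \<open>l\<close> from one point. Then \<open>l\<close> is the inradius, the
  inner parallel sets are homothetic copies of \<open>\<Omega>\<close> for \<open>t < l\<close>
  (\<open>inner_parallel_circumscribed\<close>), and they have at most one point for \<open>t \<ge> l\<close>.

  Strict monotonicity is proved directly from the definition of Hausdorff measure. The
  nearest-point map shows a strict loss when it is a contraction by a fixed factor on a part of the
  boundary that has positive measure. This is arranged by cutting the larger body with a large ball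
  instead of a half-space.
\<close>

section \<open>Hausdorff measure\<close>

lemma diameter_image_le:
  fixes f :: "'a::metric_space \<Rightarrow> 'b::metric_space"
  assumes "bounded S" "c \<ge> 0" "\<And>x y. x \<in> S \<Longrightarrow> y \<in> S \<Longrightarrow> dist (f x) (f y) \<le> c * dist x y"
  shows "bounded (f ` S)" "diameter (f ` S) \<le> c * diameter S"
proof -
  have le: "dist (f x) (f y) \<le> c * diameter S" if "x \<in> S" "y \<in> S" for x y
    using assms(3)[OF that] diameter_bounded_bound[OF assms(1) that] assms(2)
    by (meson mult_left_mono order_trans)
  then show "bounded (f ` S)"
    unfolding bounded_two_points by blast
  show "diameter (f ` S) \<le> c * diameter S"
  proof (cases "S = {}")
    case False
    then have "(SUP (x, y)\<in>f ` S \<times> f ` S. dist x y) \<le> c * diameter S"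
      using le by (intro cSUP_least) auto
    then show ?thesis
      using False unfolding diameter_def[of "f ` S"] by simp
  qed auto
qed

lemma hausdorff_weight_le:
  assumes "U \<noteq> {} \<Longrightarrow> V \<noteq> {}" "diameter U \<le> c * diameter V" "c \<ge> 0" "bounded U"
  shows "hausdorff_weight k U \<le> ennreal (c ^ k) * hausdorff_weight k V"
proof (cases "U = {}")
  case False
  have "diameter U ^ k \<le> c ^ k * diameter V ^ k"
    using power_mono[OF assms(2) diameter_ge_0[OF assms(4)], of k] by (simp add: power_mult_distrib)
  then have "unit_ball_vol (real k) / 2 ^ k * diameter U ^ k
      \<le> c ^ k * (unit_ball_vol (real k) / 2 ^ k * diameter V ^ k)"
    using mult_left_mono[of "diameter U ^ k" "c ^ k * diameter V ^ k" "unit_ball_vol (real k) / 2 ^ k"]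
    by (simp add: mult_ac)
  then show ?thesis
    using False assms(1,3) by (auto simp: hausdorff_weight_def ennreal_mult'[symmetric] intro!: ennreal_leI)
qed (simp add: hausdorff_weight_def)

lemma hausdorff_weight_mono:
  assumes "U \<subseteq> V" "bounded V"
  shows "hausdorff_weight k U \<le> hausdorff_weight k V"
  using hausdorff_weight_le[of U V 1 k] diameter_subset[OF assms] bounded_subset[OF assms(2,1)] assms(1)
  by auto

lemma hausdorff_content_le:
  assumes "E \<subseteq> (\<Union>i. U i)" "\<And>i. bounded (U i)" "\<And>i. diameter (U i) \<le> \<delta>"
  shows "hausdorff_content k \<delta> E \<le> (\<Sum>i. hausdorff_weight k (U i))"
  unfolding hausdorff_content_def using assms by (intro INF_lower) auto

lemma hausdorff_content_mono:
  "E \<subseteq> F \<Longrightarrow> hausdorff_content k \<delta> E \<le> hausdorff_content k \<delta> F"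
  unfolding hausdorff_content_def by (intro INF_superset_mono) auto

lemma hausdorff_content_antimono:
  "\<delta> \<le> \<epsilon> \<Longrightarrow> hausdorff_content k \<epsilon> E \<le> hausdorff_content k \<delta> E"
  unfolding hausdorff_content_def by (intro INF_superset_mono) (auto intro: order_trans)

lemma hausdorff_measure_mono:
  "E \<subseteq> F \<Longrightarrow> hausdorff_measure k E \<le> hausdorff_measure k F"
  unfolding hausdorff_measure_def by (intro SUP_mono') (auto intro: hausdorff_content_mono)

lemma hausdorff_content_le_measure:
  "\<delta> > 0 \<Longrightarrow> hausdorff_content k \<delta> E \<le> hausdorff_measure k E"
  unfolding hausdorff_measure_def by (intro SUP_upper) auto

text \<open>A cover of \<open>E\<close> by sets of diameter at most \<open>\<delta> / c\<close> is carried to a cover of the image by sets of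
  diameter at most \<open>\<delta>\<close>. The cover is cut down to \<open>E\<close> first, since \<open>f\<close> is controlled only there.\<close>

lemma hausdorff_measure_lipschitz_image:
  fixes f :: "'a::metric_space \<Rightarrow> 'b::metric_space"
  assumes c: "c > 0" and lip: "\<And>x y. x \<in> E \<Longrightarrow> y \<in> E \<Longrightarrow> dist (f x) (f y) \<le> c * dist x y"
  shows "hausdorff_measure k (f ` E) \<le> ennreal (c ^ k) * hausdorff_measure k E"
  unfolding hausdorff_measure_def[of k "f ` E"]
proof (rule SUP_least)
  fix \<delta> :: real assume "\<delta> \<in> {0<..}"
  then have \<delta>: "\<delta> / c > 0" using c by auto
  have inv: "ennreal (c ^ k) * (ennreal (inverse (c ^ k)) * a) = a" for a
    using c by (simp add: mult.assoc[symmetric] ennreal_mult'[symmetric])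
  have "ennreal (inverse (c ^ k)) * hausdorff_content k \<delta> (f ` E) \<le> hausdorff_content k (\<delta> / c) E"
    unfolding hausdorff_content_def[of k "\<delta> / c"]
  proof (rule INF_greatest, clarify)
    fix U :: "nat \<Rightarrow> 'a set"
    assume U: "E \<subseteq> (\<Union>i. U i)" "\<forall>i. bounded (U i) \<and> diameter (U i) \<le> \<delta> / c"
    have bU: "bounded (U i \<inter> E)" for i using U(2) by (simp add: bounded_Int)
    have dU: "diameter (U i \<inter> E) \<le> diameter (U i)" for i
      using U(2) by (simp add: diameter_subset)
    have im: "bounded (f ` (U i \<inter> E))" "diameter (f ` (U i \<inter> E)) \<le> c * diameter (U i)" for i
    proof -
      show "bounded (f ` (U i \<inter> E))"
        using diameter_image_le(1)[OF bU[of i], where c=c and f=f] c lip by auto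
      have "diameter (f ` (U i \<inter> E)) \<le> c * diameter (U i \<inter> E)"
        using diameter_image_le(2)[OF bU[of i], where c=c and f=f] c lip by auto
      also have "\<dots> \<le> c * diameter (U i)" using dU c by simp
      finally show "diameter (f ` (U i \<inter> E)) \<le> c * diameter (U i)" .
    qed
    have "hausdorff_content k \<delta> (f ` E) \<le> (\<Sum>i. hausdorff_weight k (f ` (U i \<inter> E)))"
    proof (rule hausdorff_content_le)
      fix i
      have "c * diameter (U i) \<le> \<delta>" using U(2) c by (simp add: pos_le_divide_eq mult.commute)
      then show "diameter (f ` (U i \<inter> E)) \<le> \<delta>" using im(2)[of i] by linarith
    next
      show "f ` E \<subseteq> (\<Union>i. f ` (U i \<inter> E))"
        unfolding image_UN[symmetric] using U(1) by (intro image_mono) blast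
    qed (use im in auto)
    also have "\<dots> \<le> (\<Sum>i. ennreal (c ^ k) * hausdorff_weight k (U i))"
      by (intro suminf_le hausdorff_weight_le im) (use c in auto)
    also have "\<dots> = ennreal (c ^ k) * (\<Sum>i. hausdorff_weight k (U i))" by simp
    finally have "ennreal (inverse (c ^ k)) * hausdorff_content k \<delta> (f ` E)
        \<le> ennreal (inverse (c ^ k)) * (ennreal (c ^ k) * (\<Sum>i. hausdorff_weight k (U i)))"
      by (rule mult_left_mono) simp
    then show "ennreal (inverse (c ^ k)) * hausdorff_content k \<delta> (f ` E) \<le> (\<Sum>i. hausdorff_weight k (U i))"
      using inv by (simp add: mult.left_commute)
  qed
  also have "\<dots> \<le> hausdorff_measure k E"
    by (rule hausdorff_content_le_measure[OF \<delta>])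
  finally show "hausdorff_content k \<delta> (f ` E) \<le> ennreal (c ^ k) * hausdorff_measure k E"
    using mult_left_mono[of _ _ "ennreal (c ^ k)"] inv by fastforce
qed

lemma suminf_interleave_le:
  fixes a b :: "nat \<Rightarrow> ennreal"
  shows "(\<Sum>i. if even i then a (i div 2) else b (i div 2)) \<le> (\<Sum>i. a i) + (\<Sum>i. b i)"
proof -
  let ?w = "\<lambda>i. if even i then a (i div 2) else b (i div 2)"
  have eq: "(\<Sum>i<2*n. ?w i) = (\<Sum>i<n. a i) + (\<Sum>i<n. b i)" for n
    by (induction n) (auto simp: add_ac)
  have "(\<Sum>i<n. ?w i) \<le> (\<Sum>i. a i) + (\<Sum>i. b i)" for n
  proof -
    have "(\<Sum>i<n. ?w i) \<le> (\<Sum>i<2*n. ?w i)" by (intro sum_mono2) auto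
    also have "\<dots> \<le> (\<Sum>i. a i) + (\<Sum>i. b i)"
      unfolding eq by (intro add_mono sum_le_suminf) auto
    finally show ?thesis .
  qed
  then show ?thesis unfolding suminf_eq_SUP by (intro SUP_least)
qed

lemma hausdorff_content_near_cover:
  assumes "hausdorff_content k \<delta> E < m"
  obtains U where "E \<subseteq> (\<Union>i. U i)" "\<And>i. bounded (U i)" "\<And>i. diameter (U i) \<le> \<delta>"
    "(\<Sum>i. hausdorff_weight k (U i)) < m"
  using assms unfolding hausdorff_content_def INF_less_iff by auto

lemma hausdorff_content_Un_le:
  "hausdorff_content k \<delta> (A \<union> B) \<le> hausdorff_content k \<delta> A + hausdorff_content k \<delta> B"
proof (rule ennreal_le_epsilon)
  fix e :: real assume fin: "hausdorff_content k \<delta> A + hausdorff_content k \<delta> B < top" and "e > 0"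
  have "hausdorff_content k \<delta> A < hausdorff_content k \<delta> A + ennreal (e/2)"
    "hausdorff_content k \<delta> B < hausdorff_content k \<delta> B + ennreal (e/2)"
    using fin \<open>e > 0\<close> by auto
  then obtain U V where U: "A \<subseteq> (\<Union>i. U i)" "\<And>i. bounded (U i)" "\<And>i. diameter (U i) \<le> \<delta>"
      "(\<Sum>i. hausdorff_weight k (U i)) < hausdorff_content k \<delta> A + ennreal (e/2)"
    and V: "B \<subseteq> (\<Union>i. V i)" "\<And>i. bounded (V i)" "\<And>i. diameter (V i) \<le> \<delta>"
      "(\<Sum>i. hausdorff_weight k (V i)) < hausdorff_content k \<delta> B + ennreal (e/2)"
    by (metis hausdorff_content_near_cover)
  define W where "W i = (if even i then U (i div 2) else V (i div 2))" for i :: nat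
  have WU: "U i = W (2*i)" and WV: "V i = W (2*i+1)" for i by (auto simp: W_def)
  have "A \<union> B \<subseteq> (\<Union>i. W i)" using U(1) V(1) unfolding WU WV by blast
  then have "hausdorff_content k \<delta> (A \<union> B) \<le> (\<Sum>i. hausdorff_weight k (W i))"
    by (rule hausdorff_content_le) (auto simp: W_def U V)
  also have "\<dots> = (\<Sum>i. if even i then hausdorff_weight k (U (i div 2)) else hausdorff_weight k (V (i div 2)))"
    by (intro suminf_cong) (auto simp: W_def)
  also have "\<dots> \<le> (\<Sum>i. hausdorff_weight k (U i)) + (\<Sum>i. hausdorff_weight k (V i))"
    by (rule suminf_interleave_le)
  also have "\<dots> \<le> (hausdorff_content k \<delta> A + ennreal (e/2)) + (hausdorff_content k \<delta> B + ennreal (e/2))"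
    using U(4) V(4) by (intro add_mono) auto
  also have "\<dots> = hausdorff_content k \<delta> A + hausdorff_content k \<delta> B + (ennreal (e/2) + ennreal (e/2))"
    by (simp add: add_ac)
  also have "ennreal (e/2) + ennreal (e/2) = ennreal e"
    using \<open>e > 0\<close> by (simp flip: ennreal_plus)
  finally show "hausdorff_content k \<delta> (A \<union> B) \<le> hausdorff_content k \<delta> A + hausdorff_content k \<delta> B + ennreal e" .
qed

lemma hausdorff_measure_Un_le:
  "hausdorff_measure k (A \<union> B) \<le> hausdorff_measure k A + hausdorff_measure k B"
  unfolding hausdorff_measure_def[of k "A \<union> B"]
proof (rule SUP_least)
  fix \<delta> :: real assume "\<delta> \<in> {0<..}"
  then have "hausdorff_content k \<delta> A + hausdorff_content k \<delta> B \<le> hausdorff_measure k A + hausdorff_measure k B"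
    by (intro add_mono hausdorff_content_le_measure) auto
  then show "hausdorff_content k \<delta> (A \<union> B) \<le> hausdorff_measure k A + hausdorff_measure k B"
    using hausdorff_content_Un_le[of k \<delta> A B] by (rule order_trans[rotated])
qed

lemma hausdorff_measure_empty: "hausdorff_measure k {} = 0"
proof -
  have "hausdorff_content k \<delta> {} = 0" if "\<delta> > 0" for \<delta>
    using hausdorff_content_le[of "{}" "\<lambda>_. {}" \<delta> k] that by (simp add: hausdorff_weight_def)
  then show ?thesis unfolding hausdorff_measure_def by (intro antisym SUP_least) auto
qed

lemma hausdorff_measure_singleton:
  assumes "k > 0"
  shows "hausdorff_measure k {x} = 0"
proof -
  have "hausdorff_content k \<delta> {x} = 0" if "\<delta> > 0" for \<delta>
  proof -
    have "hausdorff_weight k {x} = 0"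
      using assms by (simp add: hausdorff_weight_def zero_power)
    moreover have "hausdorff_content k \<delta> {x} \<le> (\<Sum>i::nat. hausdorff_weight k {x})"
      by (rule hausdorff_content_le) (use that in auto)
    ultimately show ?thesis by simp
  qed
  then show ?thesis unfolding hausdorff_measure_def by (intro antisym SUP_least) auto
qed

lemma hausdorff_measure_UN_finite:
  assumes "finite I" "\<And>i. i \<in> I \<Longrightarrow> hausdorff_measure k (A i) < top"
  shows "hausdorff_measure k (\<Union>i\<in>I. A i) < top"
  using assms
proof (induction I)
  case (insert j I)
  have "hausdorff_measure k (\<Union>i\<in>insert j I. A i) \<le> hausdorff_measure k (A j) + hausdorff_measure k (\<Union>i\<in>I. A i)"
    using hausdorff_measure_Un_le[of k "A j" "\<Union>i\<in>I. A i"] by simp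
  also have "\<dots> < top" using insert by simp
  finally show ?case .
qed (simp add: hausdorff_measure_empty)

text \<open>A set of diameter below \<open>d\<close> meets at most one of two sets at distance \<open>d\<close>, so a fine cover of
  the union splits into a cover of each part. This is the only form of additivity that the proof
  uses.\<close>

lemma hausdorff_measure_separated_Un:
  assumes d: "d > 0" "\<And>x y. x \<in> A \<Longrightarrow> y \<in> B \<Longrightarrow> dist x y \<ge> d"
  shows "hausdorff_measure k A + hausdorff_measure k B \<le> hausdorff_measure k (A \<union> B)"
proof -
  have small: "hausdorff_content k \<delta> A + hausdorff_content k \<delta> B \<le> hausdorff_content k \<delta> (A \<union> B)"
    if "\<delta> < d" for \<delta>
    unfolding hausdorff_content_def[of k \<delta> "A \<union> B"]
  proof (rule INF_greatest, clarify)
    fix U :: "nat \<Rightarrow> 'a set"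
    assume U: "A \<union> B \<subseteq> (\<Union>i. U i)" "\<forall>i. bounded (U i) \<and> diameter (U i) \<le> \<delta>"
    have sub: "hausdorff_content k \<delta> X \<le> (\<Sum>i. hausdorff_weight k (U i \<inter> X))" if "X \<subseteq> A \<union> B" for X
    proof (rule hausdorff_content_le)
      show "diameter (U i \<inter> X) \<le> \<delta>" for i
        using U(2) diameter_subset[of "U i \<inter> X" "U i"] by (meson Int_lower1 order_trans)
    qed (use U that in \<open>auto simp: bounded_Int\<close>)
    have disj: "U i \<inter> A = {} \<or> U i \<inter> B = {}" for i
    proof (rule ccontr)
      assume "\<not> (U i \<inter> A = {} \<or> U i \<inter> B = {})"
      then obtain x y where "x \<in> U i" "x \<in> A" "y \<in> U i" "y \<in> B" by blast
      then show False
        using d(2)[of x y] diameter_bounded_bound[of "U i" x y] U(2)[rule_format, of i] \<open>\<delta> < d\<close> by auto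
    qed
    have "hausdorff_weight k (U i \<inter> A) + hausdorff_weight k (U i \<inter> B) \<le> hausdorff_weight k (U i)" for i
      using disj[of i] U(2) hausdorff_weight_mono[of "U i \<inter> A" "U i" k] hausdorff_weight_mono[of "U i \<inter> B" "U i" k]
      by (auto simp: hausdorff_weight_def[of k "{}"])
    then have "(\<Sum>i. hausdorff_weight k (U i \<inter> A)) + (\<Sum>i. hausdorff_weight k (U i \<inter> B)) \<le> (\<Sum>i. hausdorff_weight k (U i))"
      by (subst suminf_add) (auto intro!: suminf_le)
    then show "hausdorff_content k \<delta> A + hausdorff_content k \<delta> B \<le> (\<Sum>i. hausdorff_weight k (U i))"
      using add_mono[OF sub[of A] sub[of B]] by (auto intro: order_trans)
  qed
  have "hausdorff_measure k A + hausdorff_measure k B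
      = (SUP \<delta>\<in>{0<..}. hausdorff_content k \<delta> A + hausdorff_content k \<delta> B)"
    unfolding hausdorff_measure_def
  proof (rule SUP_add_directed_ennreal[symmetric])
    fix i j :: real assume "i \<in> {0<..}" "j \<in> {0<..}"
    then show "\<exists>l\<in>{0<..}. hausdorff_content k i A + hausdorff_content k j B
        \<le> hausdorff_content k l A + hausdorff_content k l B"
      by (intro bexI[of _ "min i j"] add_mono hausdorff_content_antimono) auto
  qed
  also have "\<dots> \<le> hausdorff_measure k (A \<union> B)"
  proof (rule SUP_least)
    fix \<delta> :: real assume "\<delta> \<in> {0<..}"
    define \<epsilon> where "\<epsilon> = min \<delta> (d/2)"
    have \<epsilon>: "\<epsilon> > 0" "\<epsilon> \<le> \<delta>" "\<epsilon> < d" using d(1) \<open>\<delta> \<in> {0<..}\<close> by (auto simp: \<epsilon>_def)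
    have "hausdorff_content k \<delta> A + hausdorff_content k \<delta> B \<le> hausdorff_content k \<epsilon> A + hausdorff_content k \<epsilon> B"
      by (intro add_mono hausdorff_content_antimono \<epsilon>)
    also have "\<dots> \<le> hausdorff_measure k (A \<union> B)"
      using small[OF \<epsilon>(3)] hausdorff_content_le_measure[OF \<epsilon>(1)] by (rule order_trans)
    finally show "hausdorff_content k \<delta> A + hausdorff_content k \<delta> B \<le> hausdorff_measure k (A \<union> B)" .
  qed
  finally show ?thesis .
qed

section \<open>Monotonicity and finiteness of the perimeter\<close>

lemma bounded_ray_exits:
  fixes L :: "'a::real_normed_vector set"
  assumes "bounded L" "u \<noteq> 0"
  obtains s where "s \<ge> 0" "z + s *\<^sub>R u \<notin> L"
proof -
  obtain B where B: "B > 0" "\<And>x. x \<in> L \<Longrightarrow> norm x \<le> B"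
    using \<open>bounded L\<close> bounded_pos by metis
  define s where "s = (B + norm z + 1) / norm u"
  have "s \<ge> 0" using B(1) by (simp add: s_def)
  have "norm (s *\<^sub>R u) \<le> norm (z + s *\<^sub>R u) + norm z"
    using norm_triangle_ineq4[of "z + s *\<^sub>R u" z] by simp
  moreover have "norm (s *\<^sub>R u) = B + norm z + 1"
    using \<open>u \<noteq> 0\<close> B(1) by (simp add: s_def)
  ultimately have "z + s *\<^sub>R u \<notin> L" using B(2) by fastforce
  with \<open>s \<ge> 0\<close> show thesis by (rule that)
qed

lemma ray_meets_frontier:
  fixes L :: "'a::real_normed_vector set"
  assumes "bounded L" "z \<in> L" "u \<noteq> 0"
  obtains s where "s \<ge> 0" "z + s *\<^sub>R u \<in> frontier L"
proof -
  let ?T = "(\<lambda>s. z + s *\<^sub>R u) ` {0..}"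
  have "z \<in> ?T" by (rule image_eqI[of _ _ 0]) auto
  moreover obtain s where "s \<ge> 0" "z + s *\<^sub>R u \<notin> L"
    using bounded_ray_exits[OF assms(1,3)] by blast
  then have "?T - L \<noteq> {}" by auto
  moreover have "connected ?T"
    by (intro connected_continuous_image continuous_intros) auto
  ultimately have "?T \<inter> frontier L \<noteq> {}"
    using \<open>z \<in> L\<close> by (intro connected_Int_frontier) auto
  then show thesis using that by auto
qed

lemma convex_supporting_unit_normal:
  fixes K :: "'a::euclidean_space set"
  assumes "closed K" "convex K" "interior K \<noteq> {}" "z \<in> frontier K"
  obtains u where "norm u = 1" "\<And>y. y \<in> K \<Longrightarrow> y \<bullet> u \<le> z \<bullet> u"
proof -
  have z: "z \<in> K" "z \<notin> interior K" using assms(1,4) by (auto simp: frontier_def)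
  then obtain a where a: "a \<noteq> 0" "\<And>y. y \<in> K \<Longrightarrow> a \<bullet> z \<le> a \<bullet> y"
    using supporting_hyperplane_rel_boundary[of K z] assms(2,3) rel_interior_nonempty_interior
    by metis
  show thesis
  proof (rule that[of "- (a /\<^sub>R norm a)"])
    show "norm (- (a /\<^sub>R norm a)) = 1" using a by simp
    show "y \<bullet> - (a /\<^sub>R norm a) \<le> z \<bullet> - (a /\<^sub>R norm a)" if "y \<in> K" for y
      using a(1) a(2)[OF that] by (simp add: inner_commute divide_right_mono mult_left_mono)
  qed
qed

lemma closest_point_along_normal:
  fixes K :: "'a::euclidean_space set"
  assumes "closed K" "convex K" "z \<in> K" "norm u = 1" "\<And>y. y \<in> K \<Longrightarrow> y \<bullet> u \<le> z \<bullet> u" "s \<ge> 0"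
  shows "closest_point K (z + s *\<^sub>R u) = z"
proof (rule closest_point_unique[symmetric], (fact assms)+, rule ballI)
  fix y assume "y \<in> K"
  have "u \<bullet> u = 1" using assms(4) by (simp add: norm_eq_1)
  have "s \<le> (z + s *\<^sub>R u - y) \<bullet> u"
    using assms(5)[OF \<open>y \<in> K\<close>] \<open>u \<bullet> u = 1\<close> by (simp add: inner_diff_left inner_add_left)
  also have "\<dots> \<le> norm (z + s *\<^sub>R u - y)"
    using norm_cauchy_schwarz[of "z + s *\<^sub>R u - y" u] assms(4) by simp
  finally show "dist (z + s *\<^sub>R u) z \<le> dist (z + s *\<^sub>R u) y"
    using assms(4,6) by (simp add: dist_norm)
qed

text \<open>From a boundary point of \<open>K\<close> the ray along an outer normal leaves \<open>L\<close> through its frontier, and the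
  nearest-point map of \<open>K\<close> sends this whole ray back to its starting point. As the nearest-point map is
  1-Lipschitz, the perimeter of convex bodies is monotone.\<close>

lemma frontier_subset_closest_point_image:
  fixes K L :: "'a::euclidean_space set"
  assumes "closed K" "convex K" "interior K \<noteq> {}" "bounded L" "K \<subseteq> L"
  shows "frontier K \<subseteq> closest_point K ` frontier L"
proof
  fix z assume z: "z \<in> frontier K"
  then have "z \<in> K" using assms(1) frontier_subset_closed by auto
  obtain u where u: "norm u = 1" "\<And>y. y \<in> K \<Longrightarrow> y \<bullet> u \<le> z \<bullet> u"
    using convex_supporting_unit_normal[OF assms(1-3) z] by blast
  then have "u \<noteq> 0" by auto
  then obtain s where s: "s \<ge> 0" "z + s *\<^sub>R u \<in> frontier L"
    using ray_meets_frontier[OF assms(4), of z u] \<open>z \<in> K\<close> assms(5) by blast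
  show "z \<in> closest_point K ` frontier L"
    using closest_point_along_normal[OF assms(1,2) \<open>z \<in> K\<close> u s(1)] s(2) by (metis image_eqI)
qed

lemma hausdorff_measure_frontier_mono:
  fixes K L :: "'a::euclidean_space set"
  assumes "closed K" "convex K" "interior K \<noteq> {}" "bounded L" "K \<subseteq> L"
  shows "hausdorff_measure k (frontier K) \<le> hausdorff_measure k (frontier L)"
proof -
  have "K \<noteq> {}" using assms(3) by auto
  have "hausdorff_measure k (frontier K) \<le> hausdorff_measure k (closest_point K ` frontier L)"
    by (intro hausdorff_measure_mono frontier_subset_closest_point_image assms)
  also have "\<dots> \<le> ennreal (1 ^ k) * hausdorff_measure k (frontier L)"
    by (rule hausdorff_measure_lipschitz_image)
      (use closest_point_lipschitz[OF assms(2,1) \<open>K \<noteq> {}\<close>] in auto)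
  finally show ?thesis by simp
qed

lemma perimeter_mono:
  assumes "convex_domain K" "convex_domain L" "K \<subseteq> L"
  shows "perimeter K \<le> perimeter L"
  using assms hausdorff_measure_frontier_mono[of K L]
  by (auto simp: perimeter_def convex_domain_def compact_imp_closed compact_imp_bounded)

lemma hausdorff_content_finite_cover:
  assumes "finite I" "E \<subseteq> (\<Union>i\<in>I. C i)" "\<And>i. i \<in> I \<Longrightarrow> bounded (C i)"
    "\<And>i. i \<in> I \<Longrightarrow> diameter (C i) \<le> \<delta>" "\<delta> \<ge> 0"
    "\<And>i. i \<in> I \<Longrightarrow> hausdorff_weight k (C i) \<le> w"
  shows "hausdorff_content k \<delta> E \<le> of_nat (card I) * w"
proof -
  obtain h where h: "bij_betw h {0..<card I} I" using ex_bij_betw_nat_finite[OF assms(1)] by blast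
  then have hI: "h i \<in> I" if "i < card I" for i using that by (auto simp: bij_betw_def)
  define U where "U i = (if i < card I then C (h i) else {})" for i
  have "C i \<subseteq> (\<Union>i. U i)" if "i \<in> I" for i
  proof -
    have "i \<in> h ` {0..<card I}" using h that by (simp add: bij_betw_def)
    then obtain j where "j < card I" "i = h j" by auto
    then have "C i = U j" by (simp add: U_def)
    then show ?thesis by blast
  qed
  then have "(\<Union>i\<in>I. C i) \<subseteq> (\<Union>i. U i)" by blast
  then have "E \<subseteq> (\<Union>i. U i)" using assms(2) by (rule order_trans[rotated])
  then have "hausdorff_content k \<delta> E \<le> (\<Sum>i. hausdorff_weight k (U i))"
    by (rule hausdorff_content_le) (use assms hI in \<open>auto simp: U_def\<close>)
  also have "\<dots> = (\<Sum>i<card I. hausdorff_weight k (U i))"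
    by (rule suminf_finite) (auto simp: U_def hausdorff_weight_def)
  also have "\<dots> \<le> (\<Sum>i<card I. w)"
    using assms(6) hI by (intro sum_mono) (auto simp: U_def)
  finally show ?thesis by simp
qed

text \<open>Divide the face into a grid with \<open>N\<close> steps per side, for \<open>N\<close> large. The number of cells is of
  order \<open>N ^ (n - 1)\<close> and each has weight of order \<open>N\<close> to the power \<open>-(n - 1)\<close>, so the total stays
  bounded, here by \<open>W\<close>, while the cells become arbitrarily small.\<close>

lemma hausdorff_measure_cube_face_finite:
  fixes b :: "'a::euclidean_space" and R v :: real
  assumes b: "b \<in> Basis" and R: "R > 0"
  shows "hausdorff_measure (DIM('a) - 1) {x. x \<bullet> b = v \<and> (\<forall>i\<in>Basis. \<bar>x \<bullet> i\<bar> \<le> R)} < top"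
    (is "hausdorff_measure ?k ?F < top")
proof -
  define n where "n = DIM('a)"
  have n: "n \<ge> 1" "real n > 0" using DIM_positive[where 'a='a] unfolding n_def by linarith+
  define W where "W = unit_ball_vol (real ?k) / 2 ^ ?k * (4 * R * n) ^ ?k"
  have "hausdorff_content ?k \<delta> ?F \<le> ennreal W" if "\<delta> > 0" for \<delta>
  proof -
    obtain N0 :: nat where N0: "2 * R * n / \<delta> < N0" using reals_Archimedean2 by blast
    define N where "N = Suc N0"
    define h where "h = 2 * R / N"
    have h: "h > 0" using R by (simp add: h_def N_def)
    have hN: "h * N = 2 * R" by (simp add: h_def N_def)
    have hn: "n * h \<le> \<delta>"
    proof -
      have "2 * R * n / \<delta> \<le> N" using N0 by (simp add: N_def)
      then show ?thesis using that by (simp add: h_def N_def field_simps)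
    qed
    \<comment> \<open>Coordinates equal to \<open>R\<close> get index \<open>N\<close> rather than \<open>N - 1\<close>, hence \<open>N + 1\<close> indices per axis.\<close>
    define I where "I = PiE (Basis - {b}) (\<lambda>_. {0..N})"
    define C where "C f = {x :: 'a. x \<bullet> b = v \<and> (\<forall>i\<in>Basis - {b}. - R + h * real (f i) \<le> x \<bullet> i \<and> x \<bullet> i \<le> - R + h * (real (f i) + 1))}" for f :: "'a \<Rightarrow> nat"
    have cardI: "card I = (N + 1) ^ ?k" using b by (simp add: I_def card_PiE)
    have dC: "norm (x - y) \<le> n * h" if "x \<in> C f" "y \<in> C f" for x y f
    proof -
      have "norm (x - y) \<le> (\<Sum>i\<in>Basis. \<bar>(x - y) \<bullet> i\<bar>)" by (rule norm_le_l1)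
      also have "\<dots> \<le> (\<Sum>i\<in>(Basis::'a set). h)"
      proof (rule sum_mono)
        fix i :: 'a assume i: "i \<in> Basis"
        show "\<bar>(x - y) \<bullet> i\<bar> \<le> h"
        proof (cases "i = b")
          case False
          then have "- R + h * real (f i) \<le> x \<bullet> i" "x \<bullet> i \<le> - R + h * real (f i) + h"
            "- R + h * real (f i) \<le> y \<bullet> i" "y \<bullet> i \<le> - R + h * real (f i) + h"
            using that i by (auto simp: C_def algebra_simps)
          then show ?thesis by (simp add: inner_diff_left)
        qed (use that h in \<open>auto simp: C_def inner_diff_left\<close>)
      qed
      finally show ?thesis by (simp add: n_def)
    qed
    have bC: "bounded (C f)" for f
      unfolding bounded_two_points using dC by (metis dist_norm)
    have diam: "diameter (C f) \<le> n * h" for f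
      using dC h by (intro diameter_le) auto
    have cov: "?F \<subseteq> (\<Union>f\<in>I. C f)"
    proof
      fix x assume x: "x \<in> ?F"
      define f where "f = restrict (\<lambda>i. nat \<lfloor>(x \<bullet> i + R) / h\<rfloor>) (Basis - {b})"
      have fl: "real (nat \<lfloor>(x \<bullet> i + R) / h\<rfloor>) \<le> (x \<bullet> i + R) / h"
        "(x \<bullet> i + R) / h \<le> real (nat \<lfloor>(x \<bullet> i + R) / h\<rfloor>) + 1"
        "nat \<lfloor>(x \<bullet> i + R) / h\<rfloor> \<le> N" if "i \<in> Basis" for i
      proof -
        have "0 \<le> x \<bullet> i + R" "x \<bullet> i + R \<le> 2 * R" using x that by (auto simp: abs_le_iff)
        then have 1: "0 \<le> (x \<bullet> i + R) / h" "(x \<bullet> i + R) / h \<le> N"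
          using h hN by (auto simp: pos_divide_le_eq mult.commute)
        show "real (nat \<lfloor>(x \<bullet> i + R) / h\<rfloor>) \<le> (x \<bullet> i + R) / h"
        "(x \<bullet> i + R) / h \<le> real (nat \<lfloor>(x \<bullet> i + R) / h\<rfloor>) + 1"
          using 1(1) by linarith+
        then show "nat \<lfloor>(x \<bullet> i + R) / h\<rfloor> \<le> N" using 1(2) by linarith
      qed
      have "x \<in> C f"
        using x fl h by (auto simp: C_def f_def pos_le_divide_eq pos_divide_le_eq algebra_simps)
      moreover have "f \<in> I" using fl(3) by (auto simp: I_def f_def)
      ultimately show "x \<in> (\<Union>f\<in>I. C f)" by blast
    qed
    have wC: "hausdorff_weight ?k (C f) \<le> ennreal (unit_ball_vol (real ?k) / 2 ^ ?k * (n * h) ^ ?k)" for f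
      unfolding hausdorff_weight_def
      using diam[of f] diameter_ge_0[OF bC] by (auto intro!: ennreal_leI mult_left_mono divide_right_mono power_mono)
    have "hausdorff_content ?k \<delta> ?F \<le> of_nat (card I) * ennreal (unit_ball_vol (real ?k) / 2 ^ ?k * (n * h) ^ ?k)"
    proof (rule hausdorff_content_finite_cover[OF _ cov])
      show "finite I" by (auto simp: I_def intro!: finite_PiE)
      show "diameter (C f) \<le> \<delta>" for f using diam[of f] hn by linarith
    qed (use bC wC that in auto)
    also have "\<dots> = ennreal ((real (N + 1)) ^ ?k * (unit_ball_vol (real ?k) / 2 ^ ?k * (n * h) ^ ?k))"
      unfolding cardI
      by (simp only: ennreal_of_nat_eq_real_of_nat of_nat_power ennreal_mult'[symmetric] zero_le_power of_nat_0_le_iff)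
    also have "\<dots> \<le> ennreal W"
    proof (rule ennreal_leI)
      have "real (N + 1) * (n * h) \<le> (2 * N) * (n * h)"
        using h by (intro mult_right_mono) (auto simp: N_def)
      also have "\<dots> = 4 * R * n" using hN by (simp add: field_simps)
      finally have "(real (N + 1) * (n * h)) ^ ?k \<le> (4 * R * n) ^ ?k"
        using h by (intro power_mono) auto
      then have "unit_ball_vol (real ?k) / 2 ^ ?k * (real (N + 1) * (n * h)) ^ ?k \<le> W"
        unfolding W_def by (intro mult_left_mono) auto
      then show "(real (N + 1)) ^ ?k * (unit_ball_vol (real ?k) / 2 ^ ?k * (n * h) ^ ?k) \<le> W"
        by (simp only: power_mult_distrib mult_ac)
    qed
    finally show ?thesis .
  qed
  then have "hausdorff_measure ?k ?F \<le> ennreal W"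
    unfolding hausdorff_measure_def by (intro SUP_least) auto
  then show ?thesis by (rule le_less_trans) simp
qed

text \<open>Strictness of an inequality between perimeters can be seen only if they are finite; by
  monotonicity it is enough to look at a large cube.\<close>

lemma perimeter_finite:
  fixes L :: "'a::euclidean_space set"
  assumes "convex_domain L"
  shows "perimeter L < top"
proof -
  obtain B where B: "\<And>x. x \<in> L \<Longrightarrow> norm x \<le> B"
    using assms compact_imp_bounded bounded_iff unfolding convex_domain_def by metis
  define R where "R = \<bar>B\<bar> + 1"
  have "R > 0" by (simp add: R_def)
  let ?Q = "cbox (- (R *\<^sub>R One)) (R *\<^sub>R One) :: 'a set"
  have "box (- (R *\<^sub>R One)) (R *\<^sub>R One) \<noteq> ({} :: 'a set)"
    using \<open>R > 0\<close> by (auto simp: box_ne_empty)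
  then have "convex_domain ?Q"
    by (auto simp: convex_domain_def interior_cbox)
  moreover have "L \<subseteq> ?Q"
  proof
    fix x assume "x \<in> L"
    have "\<bar>x \<bullet> i\<bar> \<le> R" if "i \<in> Basis" for i
      using Basis_le_norm[OF that, of x] B[OF \<open>x \<in> L\<close>] by (simp add: R_def)
    then show "x \<in> ?Q" by (auto simp: mem_box abs_le_iff minus_le_iff)
  qed
  ultimately have "perimeter L \<le> perimeter ?Q" using perimeter_mono[OF assms] by blast
  also have "\<dots> \<le> hausdorff_measure (DIM('a) - 1)
      (\<Union>(b, v)\<in>Basis \<times> {R, -R}. {x::'a. x \<bullet> b = v \<and> (\<forall>i\<in>Basis. \<bar>x \<bullet> i\<bar> \<le> R)})"
    unfolding perimeter_def
  proof (rule hausdorff_measure_mono, rule subsetI)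
    fix x assume "x \<in> frontier ?Q"
    then have x: "\<forall>i\<in>Basis. - R \<le> x \<bullet> i \<and> x \<bullet> i \<le> R"
        "\<exists>b\<in>Basis. \<not> (- R < x \<bullet> b \<and> x \<bullet> b < R)"
      by (auto simp: frontier_cbox mem_box)
    then obtain b where "b \<in> Basis" "x \<bullet> b = R \<or> x \<bullet> b = - R" by force
    moreover have "\<forall>i\<in>Basis. \<bar>x \<bullet> i\<bar> \<le> R" using x(1) by force
    ultimately show "x \<in> (\<Union>(b, v)\<in>Basis \<times> {R, -R}. {x::'a. x \<bullet> b = v \<and> (\<forall>i\<in>Basis. \<bar>x \<bullet> i\<bar> \<le> R)})"
      by blast
  qed
  also have "\<dots> < top"
    by (rule hausdorff_measure_UN_finite)
      (use hausdorff_measure_cube_face_finite \<open>R > 0\<close> in auto)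
  finally show ?thesis .
qed

section \<open>Spherical patches and separating balls\<close>

lemma power2_norm_add_scaleR:
  fixes v u :: "'a::real_inner"
  shows "(norm (v + t *\<^sub>R u))^2 = (norm v)^2 + 2 * t * (v \<bullet> u) + t^2 * (norm u)^2"
  unfolding power2_norm_eq_inner
  by (simp add: inner_add_left inner_add_right inner_commute[of u v] power2_eq_square algebra_simps)

text \<open>A set of diameter \<open>d\<close>, thickened by a fixed length in one coordinate direction, lies in a box whose
  volume is at most a constant times \<open>d ^ (n - 1)\<close>. A cover of \<open>A\<close> of small total weight would thus
  give a cover of the ball by boxes of small total volume.\<close>

lemma hausdorff_measure_pos_if_thickening_has_interior:
  fixes A :: "'a::euclidean_space set"
  assumes b: "b \<in> Basis" and \<eta>: "\<eta> > 0"
    and thick: "\<And>x. x \<in> ball y \<eta> \<Longrightarrow> \<exists>a\<in>A. \<exists>\<tau>. \<bar>\<tau>\<bar> \<le> \<sigma> \<and> x = a + \<tau> *\<^sub>R b"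
  shows "hausdorff_measure (DIM('a) - 1) A > 0"
proof (rule ccontr)
  define k where "k = DIM('a) - 1"
  assume "\<not> hausdorff_measure (DIM('a) - 1) A > 0"
  then have "hausdorff_content k 1 A = 0"
    using hausdorff_content_le_measure[of 1 k A] by (simp add: k_def)
  have \<sigma>: "\<sigma> \<ge> 0" using thick[of y] \<eta> by force
  define m where "m = measure lborel (ball y \<eta>)"
  have m: "m > 0" using \<eta> by (simp add: m_def content_ball_pos)
  define \<omega> where "\<omega> = unit_ball_vol (real k) / 2 ^ k"
  have \<omega>: "\<omega> > 0" by (simp add: \<omega>_def)
  define C where "C = (2 + 2 * \<sigma>) * 2 ^ k / \<omega>"
  have C: "C > 0" using \<sigma> \<omega> by (simp add: C_def)
  have "hausdorff_content k 1 A < ennreal (m / C)"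
    using \<open>hausdorff_content k 1 A = 0\<close> m C by simp
  then obtain U where U: "A \<subseteq> (\<Union>i. U i)" "\<And>i. bounded (U i)" "\<And>i. diameter (U i) \<le> 1"
    "(\<Sum>i. hausdorff_weight k (U i)) < ennreal (m / C)"
    using hausdorff_content_near_cover by blast
  define p where "p i = (SOME x. x \<in> U i)" for i
  define d where "d i = diameter (U i)" for i
  have d: "0 \<le> d i" "d i \<le> 1" for i using U(2,3) diameter_ge_0 by (auto simp: d_def)
  define w where "w i = d i *\<^sub>R One + \<sigma> *\<^sub>R b" for i
  define V where "V i = (if U i = {} then {} else cbox (p i - w i) (p i + w i))" for i
  have wi: "w i \<bullet> j = d i + (if j = b then \<sigma> else 0)" if "j \<in> Basis" for i j
    using that b by (auto simp: w_def inner_add_left inner_Basis)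
  have cover: "ball y \<eta> \<subseteq> (\<Union>i. V i)"
  proof
    fix x assume "x \<in> ball y \<eta>"
    then obtain a \<tau> where a: "a \<in> A" "\<bar>\<tau>\<bar> \<le> \<sigma>" "x = a + \<tau> *\<^sub>R b" using thick by blast
    then obtain i where i: "a \<in> U i" using U(1) by blast
    then have pi: "p i \<in> U i" unfolding p_def by (rule someI)
    have "\<bar>(x - p i) \<bullet> j\<bar> \<le> w i \<bullet> j" if "j \<in> Basis" for j
    proof -
      have "\<bar>(a - p i) \<bullet> j\<bar> \<le> d i"
        using Basis_le_norm[OF that, of "a - p i"] diameter_bounded_bound[OF U(2) i pi]
        by (simp add: d_def dist_norm)
      moreover have "(x - p i) \<bullet> j = (a - p i) \<bullet> j + (if j = b then \<tau> else 0)"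
        using that b by (auto simp: a(3) inner_add_left inner_diff_left inner_Basis)
      ultimately show ?thesis using a(2) wi[OF that] by auto
    qed
    then have "x \<in> V i"
      using i by (force simp: V_def mem_box inner_diff_left inner_add_left abs_le_iff)
    then show "x \<in> (\<Union>i. V i)" by blast
  qed
  have vol: "emeasure lborel (V i) \<le> ennreal C * hausdorff_weight k (U i)" for i
  proof (cases "U i = {}")
    case False
    have "emeasure lborel (V i) = ennreal (\<Prod>j\<in>Basis. 2 * (w i \<bullet> j))"
      using False wi d \<sigma> by (simp add: V_def emeasure_lborel_cbox_eq inner_diff_left inner_add_left)
    also have "(\<Prod>j\<in>Basis. 2 * (w i \<bullet> j)) = 2 * (d i + \<sigma>) * (\<Prod>j\<in>Basis - {b}. 2 * d i)"
      using b wi by (subst prod.remove[OF _ b]) (auto intro!: prod.cong)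
    also have "\<dots> = 2 * (d i + \<sigma>) * (2 * d i) ^ k"
      using b by (simp add: k_def)
    also have "\<dots> \<le> (2 + 2 * \<sigma>) * (2 * d i) ^ k"
      using d[of i] \<sigma> by (intro mult_right_mono) auto
    also have "\<dots> = C * (\<omega> * d i ^ k)"
      using \<omega> by (simp add: C_def power_mult_distrib)
    finally have "emeasure lborel (V i) \<le> ennreal (C * (\<omega> * d i ^ k))"
      by (simp add: ennreal_leI)
    also have "\<dots> = ennreal C * ennreal (\<omega> * d i ^ k)"
      using C by (intro ennreal_mult') simp
    also have "ennreal (\<omega> * d i ^ k) = hausdorff_weight k (U i)"
      using False by (simp add: hausdorff_weight_def \<omega>_def d_def)
    finally show ?thesis .
  qed (simp add: V_def)
  have "ennreal m = emeasure lborel (ball y \<eta>)"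
    unfolding m_def by (rule emeasure_eq_ennreal_measure[symmetric]) (use emeasure_lborel_ball_finite[of y \<eta>] in auto)
  also have "\<dots> \<le> emeasure lborel (\<Union>i. V i)"
    by (rule emeasure_mono[OF cover]) (auto simp: V_def intro!: sets.countable_UN)
  also have "\<dots> \<le> (\<Sum>i. emeasure lborel (V i))"
    by (rule emeasure_subadditive_countably) (auto simp: V_def)
  also have "\<dots> \<le> (\<Sum>i. ennreal C * hausdorff_weight k (U i))"
    by (intro suminf_le vol) auto
  also have "\<dots> = ennreal C * (\<Sum>i. hausdorff_weight k (U i))" by simp
  also have "\<dots> < ennreal C * ennreal (m / C)"
    using U(4) C by (intro ennreal_mult_strict_left_mono) auto
  also have "\<dots> = ennreal m" using C m by (simp flip: ennreal_mult')
  finally show False by simp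
qed

text \<open>Choose a coordinate direction \<open>b\<close> that is not tangent to the sphere at \<open>y0\<close>. A short segment in
  direction \<open>b\<close> centred near \<open>y0\<close> starts on one side of the sphere and ends on the other, so the
  patch thickened along \<open>b\<close> contains a ball around \<open>y0\<close>.\<close>

lemma hausdorff_measure_sphere_patch_pos:
  fixes c y0 :: "'a::euclidean_space"
  assumes "y0 \<in> sphere c R" "R > 0" "\<delta> > 0"
  shows "hausdorff_measure (DIM('a) - 1) (sphere c R \<inter> cball y0 \<delta>) > 0"
proof -
  define w where "w = y0 - c"
  have nw: "norm w = R" using assms(1) by (simp add: w_def dist_norm norm_minus_commute)
  then have "w \<noteq> 0" using assms(2) by auto
  then obtain b where b: "b \<in> Basis" "w \<bullet> b \<noteq> 0" using euclidean_all_zero_iff by blast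
  define \<sigma> where "\<sigma> = min (\<delta>/2) \<bar>w \<bullet> b\<bar>"
  have \<sigma>: "\<sigma> > 0" "\<sigma> \<le> \<delta>/2" "\<sigma> \<le> \<bar>w \<bullet> b\<bar>" using assms(3) b(2) by (auto simp: \<sigma>_def)
  define s where "s = \<sigma> * sgn (w \<bullet> b)"
  have s: "\<bar>s\<bar> = \<sigma>" "s * (w \<bullet> b) = \<sigma> * \<bar>w \<bullet> b\<bar>" "s * s = \<sigma> * \<sigma>"
    using \<sigma>(1) b(2) by (auto simp: s_def abs_mult sgn_if abs_sgn)
  have out: "norm (w + s *\<^sub>R b) > R"
  proof (rule power2_less_imp_less)
    have "R^2 < R^2 + 2 * (\<sigma> * \<bar>w \<bullet> b\<bar>) + \<sigma> * \<sigma>" using \<sigma>(1) b(2) by (simp add: add_pos_pos)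
    also have "\<dots> = (norm (w + s *\<^sub>R b))^2"
      using power2_norm_add_scaleR[of w s b] nw s b(1) by (simp add: power2_eq_square mult.assoc)
    finally show "R^2 < (norm (w + s *\<^sub>R b))^2" .
  qed simp
  have ins: "norm (w - s *\<^sub>R b) < R"
  proof (rule power2_less_imp_less)
    have "\<sigma> * \<sigma> \<le> \<sigma> * \<bar>w \<bullet> b\<bar>" "0 < \<sigma> * \<bar>w \<bullet> b\<bar>" using \<sigma> b(2) by (auto intro!: mult_left_mono)
    then have "R^2 - 2 * (\<sigma> * \<bar>w \<bullet> b\<bar>) + \<sigma> * \<sigma> < R^2" by linarith
    also have "R^2 - 2 * (\<sigma> * \<bar>w \<bullet> b\<bar>) + \<sigma> * \<sigma> = (norm (w - s *\<^sub>R b))^2"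
      using power2_norm_add_scaleR[of w "- s" b] nw s b(1) by (simp add: power2_eq_square mult.assoc)
    finally show "(norm (w - s *\<^sub>R b))^2 < R^2" .
  qed (use assms(2) in simp)
  define G where "G = {x. norm (x + s *\<^sub>R b - c) > R} \<inter> {x. norm (x - s *\<^sub>R b - c) < R} \<inter> ball y0 (\<delta>/2)"
  have "open G"
    unfolding G_def by (intro open_Int open_Collect_less continuous_intros) auto
  moreover have "y0 \<in> G"
    using out ins assms(3) by (simp add: G_def w_def algebra_simps)
  ultimately obtain \<eta> where \<eta>: "\<eta> > 0" "ball y0 \<eta> \<subseteq> G" by (meson openE)
  show ?thesis
  proof (rule hausdorff_measure_pos_if_thickening_has_interior[OF b(1) \<eta>(1)])
    fix x assume "x \<in> ball y0 \<eta>"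
    then have x: "norm (x + s *\<^sub>R b - c) > R" "norm (x - s *\<^sub>R b - c) < R" "dist y0 x < \<delta>/2"
      using \<eta>(2) by (auto simp: G_def)
    have "\<exists>\<tau>\<ge>-1. \<tau> \<le> 1 \<and> norm (x + (\<tau> * s) *\<^sub>R b - c) = R"
      by (rule IVT') (use x in \<open>auto intro!: continuous_intros\<close>)
    then obtain \<tau> where \<tau>: "-1 \<le> \<tau>" "\<tau> \<le> 1" "norm (x + (\<tau> * s) *\<^sub>R b - c) = R" by blast
    have "\<bar>\<tau>\<bar> \<le> 1" using \<tau> by (simp add: abs_le_iff)
    then have ts: "\<bar>\<tau> * s\<bar> \<le> \<sigma>"
      using s(1) \<sigma>(1) mult_right_mono[of "\<bar>\<tau>\<bar>" 1 \<sigma>] by (simp add: abs_mult)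
    let ?a = "x + (\<tau> * s) *\<^sub>R b"
    have "?a \<in> sphere c R" using \<tau>(3) by (simp add: dist_norm norm_minus_commute)
    moreover have "?a \<in> cball y0 \<delta>"
    proof -
      have "dist y0 ?a \<le> dist y0 x + dist x ?a" by (rule dist_triangle)
      also have "dist x ?a = \<bar>\<tau> * s\<bar>" using b(1) by (simp add: dist_norm)
      finally show ?thesis using ts x(3) \<sigma>(2) by simp
    qed
    moreover have "x = ?a + (- (\<tau> * s)) *\<^sub>R b" by simp
    ultimately show "\<exists>a\<in>sphere c R \<inter> cball y0 \<delta>. \<exists>\<tau>. \<bar>\<tau>\<bar> \<le> \<sigma> \<and> x = a + \<tau> *\<^sub>R b"
      using ts by (metis IntI abs_minus_cancel)
  qed
qed

lemma closest_point_cball_outside: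
  fixes c :: "'a::euclidean_space"
  assumes "R \<ge> 0" "dist c y \<ge> R" "y \<noteq> c"
  shows "closest_point (cball c R) y = c + (R / norm (y - c)) *\<^sub>R (y - c)"
proof (rule closest_point_unique[symmetric])
  have n: "norm (y - c) > 0" "norm (y - c) \<ge> R"
    using assms by (auto simp: dist_norm norm_minus_commute)
  show "c + (R / norm (y - c)) *\<^sub>R (y - c) \<in> cball c R" using n assms(1) by (simp add: dist_norm)
  show "\<forall>z\<in>cball c R. dist y (c + (R / norm (y - c)) *\<^sub>R (y - c)) \<le> dist y z"
  proof
    fix z assume "z \<in> cball c R"
    then have "dist c z \<le> R" by simp
    have "y - (c + (R / norm (y - c)) *\<^sub>R (y - c)) = (1 - R / norm (y - c)) *\<^sub>R (y - c)"
      by (simp add: algebra_simps)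
    then have "dist y (c + (R / norm (y - c)) *\<^sub>R (y - c)) = \<bar>1 - R / norm (y - c)\<bar> * norm (y - c)"
      by (simp add: dist_norm)
    also have "\<dots> = norm (y - c) - R" using n by (simp add: field_simps)
    also have "\<dots> \<le> dist y z"
      using \<open>dist c z \<le> R\<close> dist_triangle[of y c z] by (simp add: dist_norm norm_minus_commute)
    finally show "dist y (c + (R / norm (y - c)) *\<^sub>R (y - c)) \<le> dist y z" .
  qed
qed auto

text \<open>Points outside the larger ball of radius \<open>\<kappa> * R\<close> are projected to it by a 1-Lipschitz map, and
  the homothety with ratio \<open>1 / \<kappa>\<close> takes this projection to the projection to the ball of radius \<open>R\<close>.\<close>

lemma closest_point_cball_contraction:
  fixes c :: "'a::euclidean_space"
  assumes "R > 0" "\<kappa> > 1" "dist c x \<ge> \<kappa> * R" "dist c y \<ge> \<kappa> * R"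
  shows "dist (closest_point (cball c R) x) (closest_point (cball c R) y) \<le> (1 / \<kappa>) * dist x y"
proof -
  have \<kappa>R: "\<kappa> * R > R" using assms(1,2) by simp
  have eq: "closest_point (cball c R) z - c = (1 / \<kappa>) *\<^sub>R (closest_point (cball c (\<kappa> * R)) z - c)"
    if "dist c z \<ge> \<kappa> * R" for z
  proof -
    have "dist c z > R" using that \<kappa>R by linarith
    then have "z \<noteq> c" "dist c z \<ge> R" using assms(1) by auto
    then show ?thesis
      using closest_point_cball_outside[of R c z] closest_point_cball_outside[of "\<kappa> * R" c z] that assms(1,2)
      by simp
  qed
  have "closest_point (cball c R) x - closest_point (cball c R) y
      = (closest_point (cball c R) x - c) - (closest_point (cball c R) y - c)" by simp
  also have "\<dots> = (1 / \<kappa>) *\<^sub>R (closest_point (cball c (\<kappa> * R)) x - closest_point (cball c (\<kappa> * R)) y)"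
    unfolding eq[OF assms(3)] eq[OF assms(4)] by (simp flip: scaleR_diff_right)
  finally have "dist (closest_point (cball c R) x) (closest_point (cball c R) y)
      = (1 / \<kappa>) * dist (closest_point (cball c (\<kappa> * R)) x) (closest_point (cball c (\<kappa> * R)) y)"
    using assms(2) by (simp add: dist_norm)
  also have "\<dots> \<le> (1 / \<kappa>) * dist x y"
    using closest_point_lipschitz[of "cball c (\<kappa> * R)" x y] assms(1,2) \<kappa>R
    by (intro mult_left_mono) auto
  finally show ?thesis .
qed

text \<open>A ball of large radius approximates the half-space that separates \<open>x\<close> from \<open>K\<close>.\<close>

lemma separating_ball:
  fixes K :: "'a::euclidean_space set"
  assumes "compact K" "convex K" "K \<noteq> {}" "x \<notin> K"
  obtains c R where "K \<subseteq> cball c R" "x \<notin> cball c R"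
proof -
  have cl: "closed K" using assms(1) compact_imp_closed by blast
  define z where "z = closest_point K x"
  have z: "z \<in> K" using closest_point_in_set[OF cl assms(3)] by (simp add: z_def)
  define d where "d = norm (x - z)"
  have d: "d > 0" using z assms(4) by (auto simp: d_def)
  define u where "u = (x - z) /\<^sub>R d"
  have u: "norm u = 1" using d by (simp add: u_def d_def)
  have xz: "x - z = d *\<^sub>R u" using d by (simp add: u_def)
  have Ku: "(y - z) \<bullet> u \<le> 0" if "y \<in> K" for y
  proof -
    have "(y - z) \<bullet> u = ((x - z) \<bullet> (y - z)) / d" by (simp add: u_def inner_commute divide_inverse)
    then show ?thesis
      using closest_point_dot[OF assms(2) cl that, of x] d by (simp add: z_def divide_nonpos_pos)
  qed
  obtain D where D: "\<And>y. y \<in> K \<Longrightarrow> norm (y - z) \<le> D"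
    using diameter_bounded_bound[OF compact_imp_bounded[OF assms(1)] _ z] by (metis dist_norm)
  \<comment> \<open>The ball has centre \<open>z - T u\<close> and radius \<open>sqrt (D^2 + T^2)\<close>; it misses \<open>x = z + d u\<close> as soon as
    \<open>D^2 < 2 T d + d^2\<close>, and it contains \<open>K\<close> for every \<open>T \<ge> 0\<close>.\<close>
  define T where "T = D^2 / d"
  have T: "T \<ge> 0" "2 * T * d = 2 * D^2" using d by (auto simp: T_def)
  define c where "c = z - T *\<^sub>R u"
  show thesis
  proof
    show "K \<subseteq> cball c (sqrt (D^2 + T^2))"
    proof
      fix y assume y: "y \<in> K"
      have "(norm (y - c))^2 = (norm (y - z))^2 + 2 * T * ((y - z) \<bullet> u) + T^2"
      proof -
        have eq: "y - c = (y - z) + T *\<^sub>R u" by (simp add: c_def)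
        show ?thesis
          unfolding eq power2_norm_add_scaleR using u by simp
      qed
      also have "\<dots> \<le> D^2 + T^2"
        using mult_nonneg_nonpos[OF T(1) Ku[OF y]] power_mono[OF D[OF y], of 2] by simp
      finally show "y \<in> cball c (sqrt (D^2 + T^2))"
        by (simp add: dist_norm norm_minus_commute real_le_rsqrt)
    qed
    have "x - c = (d + T) *\<^sub>R u" using xz by (simp add: c_def algebra_simps)
    then have "dist c x = d + T" using u d T(1) by (simp add: dist_norm norm_minus_commute[of c])
    moreover have "sqrt (D^2 + T^2) < d + T"
    proof (rule real_less_lsqrt)
      have "(d + T)^2 = d^2 + 2 * T * d + T^2" by (simp add: power2_eq_square algebra_simps)
      moreover have "0 < d^2" using d by simp
      moreover have "0 \<le> D^2" by simp
      ultimately show "D^2 + T^2 < (d + T)^2" using T(2) by linarith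
    qed (use d T in auto)
    ultimately show "x \<notin> cball c (sqrt (D^2 + T^2))" by simp
  qed
qed

text \<open>The separating ball misses a point of \<open>L\<close>, hence also an interior point of \<open>L\<close>. The segment from
  there to an interior point of \<open>K\<close> stays in \<open>interior L\<close> and crosses the sphere.\<close>

lemma convex_domain_strict_separating_sphere:
  fixes K L :: "'a::euclidean_space set"
  assumes K: "convex_domain K" and L: "convex_domain L" and "K \<subset> L"
  obtains c R y0 where "R > 0" "K \<subseteq> cball c R" "y0 \<in> sphere c R" "y0 \<in> interior L"
proof -
  obtain x where x: "x \<in> L" "x \<notin> K" using \<open>K \<subset> L\<close> by blast
  have "K \<noteq> {}" using K by (auto simp: convex_domain_def)
  then obtain c R where cR: "K \<subseteq> cball c R" "x \<notin> cball c R"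
    using separating_ball x(2) K unfolding convex_domain_def by metis
  obtain k where k: "k \<in> interior K" using K by (auto simp: convex_domain_def)
  have kb: "k \<in> ball c R"
    using interior_mono[OF cR(1)] k by (auto simp: interior_cball)
  then have R: "R > 0" by (metis ball_empty empty_iff not_le)
  have "k \<in> interior L" using k interior_mono[of K L] \<open>K \<subset> L\<close> by blast
  have "x \<in> closure (interior L)"
    using convex_closure_interior[of L] L x(1) closure_subset[of L] by (auto simp: convex_domain_def)
  then obtain x' where x': "x' \<in> interior L" "x' \<notin> cball c R"
    using cR(2) closure_iff_nhds_not_empty[of x "interior L"] open_Compl[OF closed_cball, of c R]
    by (metis (no_types, lifting) Compl_iff disjoint_iff order_refl)
  have "convex (interior L)" using L by (simp add: convex_domain_def convex_interior)
  then have sub: "closed_segment k x' \<subseteq> interior L"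
    using \<open>k \<in> interior L\<close> x'(1) by (simp add: closed_segment_subset)
  have "closed_segment k x' \<inter> frontier (cball c R) \<noteq> {}"
    using kb x'(2) ball_subset_cball by (intro connected_Int_frontier) (auto simp: disjoint_iff)
  then obtain y0 where "y0 \<in> closed_segment k x'" "y0 \<in> sphere c R"
    unfolding frontier_cball by blast
  then show thesis using that[OF R cR(1)] sub by blast
qed

text \<open>A monotone function has only countably many jumps, so it is continuous somewhere in \<open>{a<..<b}\<close>.
  Applied to the measure of a growing family of sets, this gives a thin layer of small measure.\<close>

lemma mono_small_increment:
  fixes m :: "real \<Rightarrow> real"
  assumes "mono m" "a < b" "e > 0"
  obtains s1 s3 where "a < s1" "s1 < s3" "s3 < b" "m s3 - m s1 < e"
proof -
  have "uncountable {a<..<b}" using assms(2) by (simp add: uncountable_open_interval)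
  then have "\<not> {a<..<b} \<subseteq> {s. \<not> isCont m s}"
    using mono_ctble_discont[OF assms(1)] countable_subset by blast
  then obtain s where s: "a < s" "s < b" "isCont m s" by auto
  then obtain d where d: "d > 0" "\<And>t. \<bar>t - s\<bar> < d \<Longrightarrow> \<bar>m t - m s\<bar> < e / 2"
    using assms(3) unfolding continuous_at_eps_delta dist_real_def by (metis half_gt_zero)
  define h where "h = min (d / 2) (min ((s - a) / 2) ((b - s) / 2))"
  have h: "h > 0" "h < d" "h < s - a" "h < b - s" using d s by (auto simp: h_def min_def)
  show thesis
  proof (rule that[of "s - h" "s + h"])
    show "m (s + h) - m (s - h) < e"
      using d(2)[of "s + h"] d(2)[of "s - h"] h(1,2) unfolding abs_less_iff by (simp add: field_simps)
  qed (use h in auto)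
qed

section \<open>Strict monotonicity of the perimeter\<close>

text \<open>This provides the distance between the sphere and the part of the outer boundary above the patch:
  a boundary point whose radial projection is close to the interior point \<open>y0\<close> must lie beyond the
  factor \<open>\<kappa>\<close>.\<close>

lemma homothets_of_ball_in_open:
  fixes c y0 :: "'a::real_normed_vector"
  assumes "open G" "y0 \<in> G"
  obtains \<delta> \<kappa> where "\<delta> > 0" "\<kappa> > 1"
    "\<And>v \<tau>. v \<in> cball y0 \<delta> \<Longrightarrow> 1 \<le> \<tau> \<Longrightarrow> \<tau> \<le> \<kappa> \<Longrightarrow> c + \<tau> *\<^sub>R (v - c) \<in> G"
proof -
  obtain e where e: "e > 0" "cball y0 e \<subseteq> G" using assms open_contains_cball by blast
  define \<delta> where "\<delta> = e / 2"
  define \<rho> where "\<rho> = dist c y0 + \<delta>"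
  define \<kappa> where "\<kappa> = 1 + \<delta> / \<rho>"
  have \<delta>: "\<delta> > 0" "e = \<delta> + \<delta>" using e by (auto simp: \<delta>_def)
  then have \<rho>: "\<rho> > 0" by (simp add: \<rho>_def add_nonneg_pos)
  show thesis
  proof
    show "\<delta> > 0" "\<kappa> > 1" using \<delta> \<rho> by (auto simp: \<kappa>_def)
    fix v \<tau> assume v: "v \<in> cball y0 \<delta>" and \<tau>: "1 \<le> \<tau>" "\<tau> \<le> \<kappa>"
    have "norm (v - c) \<le> \<rho>"
      using v dist_triangle[of c v y0] by (simp add: \<rho>_def dist_norm norm_minus_commute)
    then have "(\<tau> - 1) * norm (v - c) \<le> (\<delta> / \<rho>) * \<rho>"
      using \<tau> \<delta> \<rho> by (intro mult_mono) (auto simp: \<kappa>_def)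
    then have "norm ((\<tau> - 1) *\<^sub>R (v - c)) \<le> \<delta>" using \<tau> \<rho> by simp
    moreover have "norm (y0 - v) \<le> \<delta>" using v by (simp add: dist_norm)
    ultimately have "norm ((y0 - v) - (\<tau> - 1) *\<^sub>R (v - c)) \<le> e"
      unfolding \<delta>(2) using norm_triangle_ineq4[of "y0 - v" "(\<tau> - 1) *\<^sub>R (v - c)"] by linarith
    moreover have "(y0 - v) - (\<tau> - 1) *\<^sub>R (v - c) = y0 - (c + \<tau> *\<^sub>R (v - c))"
      by (simp add: algebra_simps)
    ultimately have "dist y0 (c + \<tau> *\<^sub>R (v - c)) \<le> e" by (simp add: dist_norm)
    then show "c + \<tau> *\<^sub>R (v - c) \<in> G" using e(2) by auto
  qed
qed

text \<open>Let \<open>D\<close> be a ball that contains \<open>K\<close> and whose bounding sphere passes through an interior point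
  \<open>y0\<close> of \<open>L\<close>. It suffices to compare \<open>L\<close> with \<open>M = L \<inter> D\<close>. The nearest-point map \<open>p\<close> of \<open>M\<close> maps
  \<open>frontier L\<close> onto a superset of \<open>frontier M\<close> without increasing measure. On the part of \<open>frontier L\<close>
  that lies above a small patch of the sphere around \<open>y0\<close>, it agrees with the projection \<open>q\<close> to \<open>D\<close>,
  and since this part keeps a positive distance from \<open>D\<close>, it is contracted in all directions by a
  factor \<open>1 / \<kappa> < 1\<close>. The part has positive measure because it projects onto the patch. (The curvature
  of the sphere matters: the projection to a hyperplane contracts in some directions only.)

  The parts above smaller and larger patches are separated by a layer whose measure is smaller than
  the gain. Outside this layer, additivity for separated sets is available.\<close>

lemma perimeter_strict_mono:
  fixes K L :: "'a::euclidean_space set"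
  assumes dim: "DIM('a) \<ge> 2" and K: "convex_domain K" and L: "convex_domain L" and "K \<subset> L"
  shows "perimeter K < perimeter L"
proof -
  define k where "k = DIM('a) - 1"
  have "k \<ge> 1" using dim by (simp add: k_def)
  obtain c R y0 where R: "R > 0" and KD: "K \<subseteq> cball c R" and y0: "y0 \<in> sphere c R" "y0 \<in> interior L"
    by (rule convex_domain_strict_separating_sphere[OF K L \<open>K \<subset> L\<close>])
  define D where "D = cball c R"
  define M where "M = L \<inter> D"
  have D: "closed D" "convex D" "D \<noteq> {}" using R by (auto simp: D_def)
  have "K \<subseteq> M" using KD \<open>K \<subset> L\<close> by (auto simp: M_def D_def)
  have "interior M \<noteq> {}"
    using K interior_mono[OF \<open>K \<subseteq> M\<close>] by (auto simp: convex_domain_def)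
  then have M: "convex_domain M"
    using L by (auto simp: M_def D_def convex_domain_def convex_Int compact_Int)
  then have M': "closed M" "convex M" "M \<noteq> {}"
    by (auto simp: convex_domain_def compact_imp_closed)
  have Lb: "bounded L" using L by (simp add: convex_domain_def compact_imp_bounded)
  define E where "E = frontier L"
  define p where "p = closest_point M"
  define q where "q = closest_point D"
  have p_lip: "dist (p x) (p y) \<le> dist x y" for x y
    unfolding p_def by (rule closest_point_lipschitz[OF M'(2,1,3)])
  have q_lip: "dist (q x) (q y) \<le> dist x y" for x y
    unfolding q_def by (rule closest_point_lipschitz[OF D(2,1,3)])
  obtain \<delta> \<kappa> where \<delta>: "\<delta> > 0" and \<kappa>: "\<kappa> > 1"
    and cone: "\<And>v \<tau>. v \<in> cball y0 \<delta> \<Longrightarrow> 1 \<le> \<tau> \<Longrightarrow> \<tau> \<le> \<kappa> \<Longrightarrow> c + \<tau> *\<^sub>R (v - c) \<in> interior L"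
    using homothets_of_ball_in_open[OF open_interior y0(2), of c] by metis
  define g where "g y = dist (q y) y0" for y
  have g_lip: "\<bar>g x - g y\<bar> \<le> dist x y" for x y
  proof -
    have "\<bar>g x - g y\<bar> \<le> dist (q x) (q y)"
      unfolding g_def using dist_triangle2[of "q x" y0 "q y"] dist_triangle2[of "q y" y0 "q x"]
      by (simp add: dist_commute abs_le_iff)
    then show ?thesis using q_lip[of x y] by linarith
  qed
  \<comment> \<open>For \<open>s \<le> \<delta>\<close>, this is the part of the frontier that lies above the patch of radius \<open>s\<close>.\<close>
  define A where "A s = {y \<in> E. g y \<le> s}" for s
  define H where "H X = hausdorff_measure k (X :: 'a set)" for X
  have HE: "H E < top" using perimeter_finite[OF L] by (simp add: H_def E_def perimeter_def k_def)
  have Hmono: "H X \<le> H Y" if "X \<subseteq> Y" for X Y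
    unfolding H_def by (rule hausdorff_measure_mono[OF that])
  have Hfin: "H X < top" if "X \<subseteq> E" for X
    using Hmono[OF that] HE by (rule le_less_trans)
  have far: "dist c y \<ge> \<kappa> * R" "p y = q y" if "y \<in> A \<delta>" for y
  proof -
    have y: "y \<in> E" "q y \<in> cball y0 \<delta>" using that by (auto simp: A_def g_def dist_commute)
    have yL: "y \<notin> interior L" using y(1) by (auto simp: E_def frontier_def)
    have "c + 1 *\<^sub>R (q y - c) \<in> interior L" using y(2) \<kappa> by (intro cone) auto
    then have qL: "q y \<in> interior L" by simp
    then have "q y \<noteq> y" using yL by auto
    then have "y \<notin> D" unfolding q_def using closest_point_self by metis
    then have yR: "dist c y > R" by (simp add: D_def)
    then have "y \<noteq> c" using R by auto
    then have qy: "q y - c = (R / norm (y - c)) *\<^sub>R (y - c)"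
      unfolding q_def D_def using closest_point_cball_outside[of R c y] R yR by simp
    show "dist c y \<ge> \<kappa> * R"
    proof (rule ccontr)
      assume "\<not> dist c y \<ge> \<kappa> * R"
      then have "c + (norm (y - c) / R) *\<^sub>R (q y - c) \<in> interior L"
        using y(2) yR R by (intro cone) (auto simp: dist_norm norm_minus_commute pos_divide_le_eq)
      moreover have "c + (norm (y - c) / R) *\<^sub>R (q y - c) = y"
        unfolding qy using R \<open>y \<noteq> c\<close> by simp
      ultimately show False using yL by simp
    qed
    have "q y \<in> M"
      using qL interior_subset[of L] closest_point_in_set[OF D(1,3)] by (auto simp: M_def q_def)
    moreover have "\<forall>z\<in>M. dist y (q y) \<le> dist y z"
      using closest_point_le[OF D(1)] by (auto simp: M_def q_def)
    ultimately show "p y = q y"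
      unfolding p_def using closest_point_unique[OF M'(2,1)] by metis
  qed
  have contract: "dist (p x) (p y) \<le> (1 / \<kappa>) * dist x y" if "x \<in> A \<delta>" "y \<in> A \<delta>" for x y
    using closest_point_cball_contraction[OF R \<kappa> far(1)[OF that(1)] far(1)[OF that(2)]]
    by (simp add: far(2) that q_def D_def)
  have pos: "H (A (\<delta>/2)) > 0"
  proof -
    have "sphere c R \<inter> cball y0 (\<delta>/2) \<subseteq> q ` A (\<delta>/2)"
    proof
      fix v assume v: "v \<in> sphere c R \<inter> cball y0 (\<delta>/2)"
      then have nv: "norm (v - c) = R" by (simp add: dist_norm norm_minus_commute)
      then have "v - c \<noteq> 0" using R by auto
      have "c + 1 *\<^sub>R (v - c) \<in> interior L" using v \<delta> \<kappa> by (intro cone) auto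
      then have "v \<in> L" using interior_subset[of L] by auto
      then obtain s where s: "s \<ge> 0" "v + s *\<^sub>R (v - c) \<in> E"
        using ray_meets_frontier[OF Lb _ \<open>v - c \<noteq> 0\<close>] unfolding E_def by blast
      define y where "y = v + s *\<^sub>R (v - c)"
      have yc: "y - c = (1 + s) *\<^sub>R (v - c)" by (simp add: y_def algebra_simps)
      then have ny: "norm (y - c) = (1 + s) * R" using s(1) nv by simp
      then have "dist c y \<ge> R" using s(1) R by (simp add: dist_norm norm_minus_commute)
      moreover have "y \<noteq> c" using ny s(1) R by auto
      ultimately have "q y = c + (R / norm (y - c)) *\<^sub>R (y - c)"
        unfolding q_def D_def using closest_point_cball_outside[of R c y] R by simp
      also have "\<dots> = v" unfolding ny yc using s(1) R nv by simp
      finally have "q y = v" .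
      moreover have "y \<in> A (\<delta>/2)"
        using s(2) v \<open>q y = v\<close> by (simp add: A_def g_def dist_commute y_def)
      ultimately show "v \<in> q ` A (\<delta>/2)" by blast
    qed
    then have "H (sphere c R \<inter> cball y0 (\<delta>/2)) \<le> H (q ` A (\<delta>/2))" by (rule Hmono)
    also have "\<dots> \<le> ennreal (1 ^ k) * H (A (\<delta>/2))"
      unfolding H_def by (rule hausdorff_measure_lipschitz_image) (use q_lip in auto)
    finally have "H (sphere c R \<inter> cball y0 (\<delta>/2)) \<le> H (A (\<delta>/2))" by simp
    moreover have "H (sphere c R \<inter> cball y0 (\<delta>/2)) > 0"
      unfolding H_def k_def by (rule hausdorff_measure_sphere_patch_pos) (use y0 R \<delta> in auto)
    ultimately show ?thesis by (rule less_le_trans[rotated])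
  qed
  define m where "m s = enn2real (H (A s))" for s
  have Am: "A s \<subseteq> A s'" if "s \<le> s'" for s s' using that by (auto simp: A_def)
  have AE: "A s \<subseteq> E" for s by (auto simp: A_def)
  have Hm: "H (A s) = ennreal (m s)" for s
    using Hfin[OF AE, of s] by (simp add: m_def)
  have mm: "mono m"
    unfolding mono_def m_def using Hmono[OF Am] Hfin[OF AE] by (auto intro!: enn2real_mono)
  define h where "h = m (\<delta>/2)"
  have h: "h > 0" using pos Hm[of "\<delta>/2"] by (simp add: h_def)
  define \<theta> where "\<theta> = (1 / \<kappa>) ^ k"
  have \<theta>: "0 \<le> \<theta>" "\<theta> < 1"
    using \<kappa> \<open>k \<ge> 1\<close> by (auto simp: \<theta>_def intro!: power_less_one_iff[THEN iffD2])
  obtain s1 s3 where s: "\<delta>/2 < s1" "s1 < s3" "s3 < \<delta>" "m s3 - m s1 < (1 - \<theta>) * h"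
    using mono_small_increment[OF mm, of "\<delta>/2" \<delta> "(1 - \<theta>) * h"] \<delta> \<theta> h by auto
  define s2 where "s2 = (s1 + s3) / 2"
  have s2: "s1 < s2" "s2 < s3" using s by (auto simp: s2_def)
  \<comment> \<open>The layer \<open>N\<close> lies in \<open>A s3\<close> and is separated from \<open>A s1\<close>, so its measure is at most \<open>m s3 - m s1\<close>.\<close>
  define N where "N = {y \<in> E. s2 \<le> g y \<and> g y \<le> s3}"
  define B where "B = {y \<in> E. s3 \<le> g y}"
  have sub: "N \<subseteq> E" "B \<subseteq> E" by (auto simp: N_def B_def)
  obtain \<nu> \<beta> where \<nu>\<beta>: "H N = ennreal \<nu>" "\<nu> \<ge> 0" "H B = ennreal \<beta>" "\<beta> \<ge> 0"
    using Hfin[OF sub(1)] Hfin[OF sub(2)] by (metis less_top_ennreal)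
  have m0: "m s \<ge> 0" for s by (simp add: m_def)
  have "H (A s1) + H N \<le> H (A s1 \<union> N)"
    unfolding H_def
  proof (rule hausdorff_measure_separated_Un)
    show "dist x y \<ge> s2 - s1" if "x \<in> A s1" "y \<in> N" for x y
      using that g_lip[of x y] by (auto simp: A_def N_def)
  qed (use s2 in simp)
  also have "\<dots> \<le> H (A s3)" by (rule Hmono) (use s2 in \<open>auto simp: A_def N_def\<close>)
  finally have "\<nu> \<le> m s3 - m s1"
    using \<nu>\<beta> m0 unfolding Hm by (simp flip: ennreal_plus)
  then have \<nu>: "\<nu> < (1 - \<theta>) * h" using s(4) by linarith
  have "H (A s2) + H B \<le> H (A s2 \<union> B)"
    unfolding H_def
  proof (rule hausdorff_measure_separated_Un)
    show "dist x y \<ge> s3 - s2" if "x \<in> A s2" "y \<in> B" for x y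
      using that g_lip[of x y] by (auto simp: A_def B_def)
  qed (use s2 in simp)
  also have "\<dots> \<le> H E" by (rule Hmono) (auto simp: A_def B_def)
  finally have big: "ennreal (m s2 + \<beta>) \<le> H E"
    using \<nu>\<beta> m0 unfolding Hm by simp
  have p1: "H (p ` X) \<le> H X" for X
    unfolding H_def using hausdorff_measure_lipschitz_image[of 1 X p k] p_lip by simp
  have p2: "H (p ` A s2) \<le> ennreal (\<theta> * m s2)"
  proof -
    have "A s2 \<subseteq> A \<delta>" using Am s s2 by simp
    then have "H (p ` A s2) \<le> ennreal ((1 / \<kappa>) ^ k) * H (A s2)"
      unfolding H_def using contract \<kappa> by (intro hausdorff_measure_lipschitz_image) auto
    then show ?thesis using \<theta> unfolding Hm \<theta>_def by (simp flip: ennreal_mult')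
  qed
  have "h \<le> m s2" unfolding h_def using mm s s2 by (auto simp: mono_def)
  have "perimeter K \<le> perimeter M" by (rule perimeter_mono[OF K M \<open>K \<subseteq> M\<close>])
  also have "\<dots> \<le> H (p ` E)"
    unfolding perimeter_def H_def k_def p_def E_def
    by (intro hausdorff_measure_mono frontier_subset_closest_point_image)
      (use M' \<open>interior M \<noteq> {}\<close> Lb in \<open>auto simp: M_def\<close>)
  also have "\<dots> \<le> H (p ` A s2 \<union> (p ` N \<union> p ` B))"
    by (rule Hmono) (force simp: A_def N_def B_def)
  also have "\<dots> \<le> H (p ` A s2) + H (p ` N \<union> p ` B)"
    unfolding H_def by (rule hausdorff_measure_Un_le)
  also have "\<dots> \<le> H (p ` A s2) + (H (p ` N) + H (p ` B))"
    unfolding H_def by (intro add_left_mono hausdorff_measure_Un_le)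
  also have "\<dots> \<le> ennreal (\<theta> * m s2) + (ennreal \<nu> + ennreal \<beta>)"
    by (intro add_mono p2) (use p1[of N] p1[of B] \<nu>\<beta> in auto)
  also have "\<dots> = ennreal (\<theta> * m s2 + (\<nu> + \<beta>))"
    using \<theta> m0 \<nu>\<beta> by simp
  also have "\<dots> < ennreal (m s2 + \<beta>)"
  proof (rule ennreal_lessI)
    have "(1 - \<theta>) * h \<le> (1 - \<theta>) * m s2" using \<open>h \<le> m s2\<close> \<theta> by (intro mult_left_mono) auto
    then have "\<nu> < m s2 - \<theta> * m s2" using \<nu> by (simp add: left_diff_distrib)
    then show "\<theta> * m s2 + (\<nu> + \<beta>) < m s2 + \<beta>" by simp
    show "0 < m s2 + \<beta>" using h \<open>h \<le> m s2\<close> \<nu>\<beta> by simp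
  qed
  also have "\<dots> \<le> perimeter L" using big by (simp add: H_def E_def perimeter_def k_def)
  finally show ?thesis .
qed

section \<open>Inner parallel sets and the inradius\<close>

lemma inner_parallel_iff_cball_subset:
  fixes \<Omega> :: "'a::euclidean_space set"
  assumes "compact \<Omega>" "t \<ge> 0"
  shows "x \<in> inner_parallel \<Omega> t \<longleftrightarrow> cball x t \<subseteq> \<Omega>"
proof
  assume x: "x \<in> inner_parallel \<Omega> t"
  show "cball x t \<subseteq> \<Omega>"
  proof (cases "t = 0")
    case False
    have "ball x t \<subseteq> \<Omega>"
    proof
      fix y assume y: "y \<in> ball x t"
      show "y \<in> \<Omega>"
      proof (rule ccontr)
        assume "y \<notin> \<Omega>"
        then have "infdist x (- \<Omega>) \<le> dist x y" by (intro infdist_le) auto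
        then show False using x y by (auto simp: inner_parallel_def)
      qed
    qed
    then have "closure (ball x t) \<subseteq> \<Omega>"
      using assms(1) by (simp add: closure_minimal compact_imp_closed)
    then show ?thesis using False assms(2) by simp
  qed (use x in \<open>auto simp: inner_parallel_def\<close>)
next
  assume sub: "cball x t \<subseteq> \<Omega>"
  have "- \<Omega> \<noteq> {}" using assms(1) compact_imp_bounded not_bounded_UNIV by (metis Compl_empty_eq double_compl)
  then have "infdist x (- \<Omega>) \<ge> t"
    unfolding infdist_notempty[OF \<open>- \<Omega> \<noteq> {}\<close>] using sub
    by (intro cINF_greatest) (auto simp: subset_iff not_le intro: less_imp_le)
  then show "x \<in> inner_parallel \<Omega> t" using sub assms(2) by (auto simp: inner_parallel_def)
qed

lemma inner_parallel_0: "inner_parallel \<Omega> 0 = \<Omega>"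
  by (auto simp: inner_parallel_def infdist_nonneg)

lemma inradius_eqI:
  assumes "0 \<le> r" "cball x r \<subseteq> \<Omega>" "\<And>y \<rho>. 0 \<le> \<rho> \<Longrightarrow> cball y \<rho> \<subseteq> \<Omega> \<Longrightarrow> \<rho> \<le> r"
  shows "inradius \<Omega> = r"
  unfolding inradius_def using assms by (intro cSup_eq_maximum) auto

lemma inball_exists:
  fixes \<Omega> :: "'a::euclidean_space set"
  assumes "convex_domain \<Omega>"
  obtains x0 where "inradius \<Omega> > 0" "cball x0 (inradius \<Omega>) \<subseteq> \<Omega>"
proof -
  have c: "compact \<Omega>" and ne: "\<Omega> \<noteq> {}" using assms by (auto simp: convex_domain_def)
  have "continuous_on \<Omega> (\<lambda>x. infdist x (- \<Omega>))" by (intro continuous_intros)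
  then obtain x0 where x0: "x0 \<in> \<Omega>" "\<And>y. y \<in> \<Omega> \<Longrightarrow> infdist y (- \<Omega>) \<le> infdist x0 (- \<Omega>)"
    using continuous_attains_sup[OF c ne] by blast
  define r where "r = infdist x0 (- \<Omega>)"
  have r0: "r \<ge> 0" by (simp add: r_def infdist_nonneg)
  have r1: "cball x0 r \<subseteq> \<Omega>"
    using inner_parallel_iff_cball_subset[OF c r0, of x0] x0(1) by (simp add: inner_parallel_def r_def)
  have r2: "\<rho> \<le> r" if "0 \<le> \<rho>" "cball y \<rho> \<subseteq> \<Omega>" for y \<rho>
    using inner_parallel_iff_cball_subset[OF c that(1), of y] that(2) x0(2)[of y]
    by (auto simp: inner_parallel_def r_def)
  have eq: "inradius \<Omega> = r" by (rule inradius_eqI[OF r0 r1 r2])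
  obtain z e where "e > 0" "cball z e \<subseteq> \<Omega>"
    using assms unfolding convex_domain_def by (metis all_not_in_conv mem_interior_cball)
  then have "r > 0" using r2[of e z] by simp
  then show thesis using that[of x0] r1 eq by simp
qed

lemma compact_inner_parallel:
  fixes \<Omega> :: "'a::euclidean_space set"
  assumes "compact \<Omega>"
  shows "compact (inner_parallel \<Omega> t)"
proof -
  have "closed {x. t \<le> infdist x (- \<Omega>)}"
    by (intro closed_Collect_le continuous_intros)
  then have "compact (\<Omega> \<inter> {x. t \<le> infdist x (- \<Omega>)})" by (rule compact_Int_closed[OF assms])
  then show ?thesis by (simp add: inner_parallel_def Int_def)
qed

lemma convex_inner_parallel:
  fixes \<Omega> :: "'a::euclidean_space set"
  assumes "compact \<Omega>" "convex \<Omega>" "t \<ge> 0"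
  shows "convex (inner_parallel \<Omega> t)"
proof (rule convexI)
  fix x y :: 'a and u v :: real
  assume x: "x \<in> inner_parallel \<Omega> t" and y: "y \<in> inner_parallel \<Omega> t" and uv: "0 \<le> u" "0 \<le> v" "u + v = 1"
  have "z \<in> \<Omega>" if "z \<in> cball (u *\<^sub>R x + v *\<^sub>R y) t" for z
  proof -
    define w where "w = z - (u *\<^sub>R x + v *\<^sub>R y)"
    have "norm w \<le> t" using that by (simp add: w_def dist_norm norm_minus_commute)
    then have "x + w \<in> \<Omega>" "y + w \<in> \<Omega>"
      using x y inner_parallel_iff_cball_subset[OF assms(1,3)] by (auto simp: subset_iff dist_norm)
    then have "u *\<^sub>R (x + w) + v *\<^sub>R (y + w) \<in> \<Omega>" using assms(2) uv by (auto simp: convex_def)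
    moreover have "u *\<^sub>R (x + w) + v *\<^sub>R (y + w) = u *\<^sub>R x + v *\<^sub>R y + (u + v) *\<^sub>R w"
      by (simp add: algebra_simps)
    ultimately show ?thesis using uv(3) by (simp add: w_def)
  qed
  then show "u *\<^sub>R x + v *\<^sub>R y \<in> inner_parallel \<Omega> t"
    using inner_parallel_iff_cball_subset[OF assms(1,3)] by blast
qed

section \<open>Homotheties\<close>

lemma hausdorff_measure_similarity_image:
  assumes "s > 0" "\<And>x y. x \<in> E \<Longrightarrow> y \<in> E \<Longrightarrow> dist (f x) (f y) = s * dist x y"
  shows "hausdorff_measure k (f ` E) = ennreal (s ^ k) * hausdorff_measure k E"
proof (rule antisym)
  show "hausdorff_measure k (f ` E) \<le> ennreal (s ^ k) * hausdorff_measure k E"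
    by (rule hausdorff_measure_lipschitz_image) (use assms in auto)
  have inj: "inj_on f E"
  proof (rule inj_onI)
    fix x y assume "x \<in> E" "y \<in> E" "f x = f y"
    then show "x = y" using assms(2)[of x y] assms(1) by simp
  qed
  define g where "g = the_inv_into E f"
  have gf: "g (f x) = x" if "x \<in> E" for x using the_inv_into_f_f[OF inj that] by (simp add: g_def)
  have "hausdorff_measure k (g ` f ` E) \<le> ennreal ((1 / s) ^ k) * hausdorff_measure k (f ` E)"
  proof (rule hausdorff_measure_lipschitz_image)
    fix x y assume "x \<in> f ` E" "y \<in> f ` E"
    then show "dist (g x) (g y) \<le> (1 / s) * dist x y"
      using assms gf by auto
  qed (use assms(1) in simp)
  also have "g ` f ` E = E" using gf by force
  finally have "ennreal (s ^ k) * hausdorff_measure k E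
      \<le> ennreal (s ^ k) * (ennreal ((1 / s) ^ k) * hausdorff_measure k (f ` E))"
    by (rule mult_left_mono) simp
  also have "\<dots> = hausdorff_measure k (f ` E)"
    using assms(1) by (simp add: mult.assoc[symmetric] ennreal_mult'[symmetric] power_mult_distrib[symmetric])
  finally show "ennreal (s ^ k) * hausdorff_measure k E \<le> hausdorff_measure k (f ` E)" .
qed

definition homothet :: "'a::real_vector \<Rightarrow> real \<Rightarrow> 'a \<Rightarrow> 'a" where
  "homothet x0 s x = x0 + s *\<^sub>R (x - x0)"

lemma homothet_image_eq: "homothet x0 s ` S = (+) (x0 - s *\<^sub>R x0) ` (\<lambda>x. s *\<^sub>R x) ` S"
  unfolding image_image by (rule image_cong) (auto simp: homothet_def algebra_simps)

lemma interior_homothet_image: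
  fixes S :: "'a::euclidean_space set"
  assumes "s > 0"
  shows "interior (homothet x0 s ` S) = homothet x0 s ` interior S"
  unfolding homothet_image_eq interior_translation using assms
  by (simp add: interior_injective_linear_image linear_scaleR inj_on_def)

lemma frontier_homothet_image:
  fixes S :: "'a::euclidean_space set"
  assumes "s > 0"
  shows "frontier (homothet x0 s ` S) = homothet x0 s ` frontier S"
proof -
  have "inj (homothet x0 s)" using assms by (auto simp: homothet_def inj_on_def)
  moreover have "closure (homothet x0 s ` S) = homothet x0 s ` closure S"
    unfolding homothet_image_eq closure_translation using closure_scaleR[of s S] by simp
  ultimately show ?thesis
    unfolding frontier_def by (simp only: interior_homothet_image[OF assms] image_set_diff)
qed

lemma convex_domain_homothet_image:
  fixes \<Omega> :: "'a::euclidean_space set"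
  assumes "s > 0" "convex_domain \<Omega>"
  shows "convex_domain (homothet x0 s ` \<Omega>)"
  unfolding convex_domain_def interior_homothet_image[OF assms(1)]
  using assms(2) unfolding convex_domain_def homothet_image_eq
  by (auto intro!: compact_translation compact_scaling convex_translation convex_scaling)

lemma perimeter_homothet_image:
  fixes \<Omega> :: "'a::euclidean_space set"
  assumes "s > 0"
  shows "perimeter (homothet x0 s ` \<Omega>) = ennreal (s ^ (DIM('a) - 1)) * perimeter \<Omega>"
  unfolding perimeter_def frontier_homothet_image[OF assms]
  by (rule hausdorff_measure_similarity_image[OF assms])
    (use assms in \<open>simp add: homothet_def dist_norm flip: scaleR_diff_right\<close>)

text \<open>For \<open>s = 1 - t / r\<close>, the ball of radius \<open>t\<close> around the homothetic image of \<open>y\<close> is the convex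
  combination with weights \<open>s\<close> and \<open>1 - s\<close> of \<open>y\<close> and the ball \<open>cball x0 r\<close>.\<close>

lemma homothet_image_subset_inner_parallel:
  fixes \<Omega> :: "'a::euclidean_space set"
  assumes "compact \<Omega>" "convex \<Omega>" "cball x0 r \<subseteq> \<Omega>" "0 < t" "t \<le> r"
  shows "homothet x0 (1 - t / r) ` \<Omega> \<subseteq> inner_parallel \<Omega> t"
proof clarify
  fix y assume y: "y \<in> \<Omega>"
  define s where "s = 1 - t / r"
  have s: "0 \<le> s" "0 < 1 - s" "(1 - s) * r = t" using assms(4,5) by (auto simp: s_def)
  have "cball (homothet x0 s y) t \<subseteq> \<Omega>"
  proof
    fix v assume v: "v \<in> cball (homothet x0 s y) t"
    define w where "w = x0 + (1 / (1 - s)) *\<^sub>R (v - homothet x0 s y)"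
    have "norm (v - homothet x0 s y) \<le> (1 - s) * r" using v s(3) by (simp add: dist_norm norm_minus_commute)
    then have "w \<in> cball x0 r" using s(2) by (simp add: w_def dist_norm pos_divide_le_eq mult.commute)
    then have "s *\<^sub>R y + (1 - s) *\<^sub>R w \<in> \<Omega>"
      using assms(2,3) y s by (intro convexD) auto
    moreover have "s *\<^sub>R y + (1 - s) *\<^sub>R w = s *\<^sub>R y + (1 - s) *\<^sub>R x0 + (v - homothet x0 s y)"
      using s(2) by (simp add: w_def scaleR_add_right)
    moreover have "\<dots> = v" by (simp add: homothet_def algebra_simps)
    ultimately show "v \<in> \<Omega>" by simp
  qed
  then show "homothet x0 (1 - t / r) y \<in> inner_parallel \<Omega> t"
    using inner_parallel_iff_cball_subset[OF assms(1)] assms(4) by (simp add: s_def)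
qed

section \<open>Regular points and supporting hyperplanes\<close>

lemma support_function_upper:
  fixes \<Omega> :: "'a::euclidean_space set"
  assumes "compact \<Omega>" "x \<in> \<Omega>"
  shows "x \<bullet> u \<le> support_function \<Omega> u"
proof -
  have "compact ((\<lambda>x. x \<bullet> u) ` \<Omega>)"
    using assms(1) by (intro compact_continuous_image continuous_intros)
  then have "bdd_above ((\<lambda>x. x \<bullet> u) ` \<Omega>)"
    by (intro bounded_imp_bdd_above compact_imp_bounded)
  then show ?thesis unfolding support_function_def using assms(2) by (intro cSUP_upper)
qed

lemma support_function_eqI:
  assumes "x \<in> \<Omega>" "\<And>y. y \<in> \<Omega> \<Longrightarrow> y \<bullet> u \<le> x \<bullet> u"
  shows "support_function \<Omega> u = x \<bullet> u"
  unfolding support_function_def using assms by (intro cSup_eq_maximum) auto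

lemma cball_support_function_le:
  fixes \<Omega> :: "'a::euclidean_space set"
  assumes "compact \<Omega>" "cball w \<rho> \<subseteq> \<Omega>" "\<rho> \<ge> 0" "norm u = 1"
  shows "w \<bullet> u + \<rho> \<le> support_function \<Omega> u"
proof -
  have "w + \<rho> *\<^sub>R u \<in> \<Omega>" using assms(2-4) by (auto simp: subset_iff dist_norm)
  then show ?thesis
    using support_function_upper[OF assms(1), of "w + \<rho> *\<^sub>R u" u] assms(4)
    by (simp add: inner_add_left norm_eq_1)
qed

text \<open>A supporting hyperplane of \<open>\<Omega>\<close> at the point of contact also supports the ball, and the ball has only
  one such hyperplane. Touching balls thus supply enough regular points to recover \<open>\<Omega>\<close>.\<close>

lemma touching_ball_regular_point:
  fixes \<Omega> :: "'a::euclidean_space set"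
  assumes \<Omega>: "convex_domain \<Omega>" and w: "cball w \<rho> \<subseteq> \<Omega>" "\<rho> > 0"
    and y: "y \<in> frontier \<Omega>" "dist w y = \<rho>"
  defines "u \<equiv> (1 / \<rho>) *\<^sub>R (y - w)"
  shows "regular_point \<Omega> y" "norm u = 1" "support_function \<Omega> u = y \<bullet> u" "y = w + \<rho> *\<^sub>R u"
    "u \<in> regular_normals \<Omega>"
proof -
  have c: "compact \<Omega>" "closed \<Omega>" "convex \<Omega>" "interior \<Omega> \<noteq> {}"
    using \<Omega> by (auto simp: convex_domain_def compact_imp_closed)
  show u1: "norm u = 1" using y(2) w(2) by (simp add: u_def dist_norm norm_minus_commute)
  show yw: "y = w + \<rho> *\<^sub>R u" using w(2) by (simp add: u_def)
  have unique: "v = u" if "norm v = 1" "y \<bullet> v = support_function \<Omega> v" for v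
  proof -
    have "w \<bullet> v + \<rho> \<le> y \<bullet> v"
      using cball_support_function_le[OF c(1) w(1) _ that(1)] w(2) that(2) by simp
    then have "\<rho> \<le> \<rho> * (u \<bullet> v)" unfolding yw by (simp add: inner_add_left)
    then have "1 \<le> u \<bullet> v" using w(2) by simp
    moreover have "(norm (u - v))^2 = 2 - 2 * (u \<bullet> v)"
      using power2_norm_add_scaleR[of u "-1" v] u1 that(1) by simp
    ultimately have "(norm (u - v))^2 \<le> 0" by linarith
    then show ?thesis by simp
  qed
  obtain v where v: "norm v = 1" "\<And>x. x \<in> \<Omega> \<Longrightarrow> x \<bullet> v \<le> y \<bullet> v"
    using convex_supporting_unit_normal[OF c(2-4) y(1)] by blast
  have y\<Omega>: "y \<in> \<Omega>" using y(1) frontier_subset_closed[OF c(2)] by blast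
  have sv: "support_function \<Omega> v = y \<bullet> v" by (rule support_function_eqI[OF y\<Omega> v(2)])
  then have "v = u" using unique[OF v(1)] by simp
  then show su: "support_function \<Omega> u = y \<bullet> u" using sv by simp
  show reg: "regular_point \<Omega> y"
    unfolding regular_point_def
  proof (intro conjI y(1) ex1I[of _ u])
    show "u \<in> sphere 0 1" "y \<bullet> u = support_function \<Omega> u" using u1 su by auto
    show "v' = u" if "v' \<in> sphere 0 1 \<and> y \<bullet> v' = support_function \<Omega> v'" for v'
      using unique[of v'] that by simp
  qed
  show "u \<in> regular_normals \<Omega>"
    unfolding regular_normals_def using reg u1 su by auto
qed

lemma largest_ball_touches_frontier:
  fixes \<Omega> :: "'a::euclidean_space set"
  assumes "compact \<Omega>" "w \<in> interior \<Omega>"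
  obtains y where "y \<in> frontier \<Omega>" "dist w y > 0" "cball w (dist w y) \<subseteq> \<Omega>"
    "\<And>z. z \<in> frontier \<Omega> \<Longrightarrow> dist w y \<le> dist w z"
proof -
  have w: "w \<in> \<Omega>" "w \<notin> frontier \<Omega>" using assms(2) interior_subset by (auto simp: frontier_def)
  have "frontier \<Omega> \<noteq> {}"
    using w assms(1) compact_imp_bounded not_bounded_UNIV by (intro frontier_not_empty) auto
  then obtain y where y: "y \<in> frontier \<Omega>" "\<And>z. z \<in> frontier \<Omega> \<Longrightarrow> dist w y \<le> dist w z"
    using distance_attains_inf[of "frontier \<Omega>" w] by auto
  have pos: "dist w y > 0" using y(1) w(2) by auto
  have "ball w (dist w y) \<subseteq> \<Omega>"
  proof (rule ccontr)
    assume "\<not> ball w (dist w y) \<subseteq> \<Omega>"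
    moreover have "w \<in> ball w (dist w y)" using pos by simp
    ultimately have "ball w (dist w y) \<inter> frontier \<Omega> \<noteq> {}"
      using w(1) by (intro connected_Int_frontier connected_ball) blast+
    then show False using y(2) by fastforce
  qed
  then have "closure (ball w (dist w y)) \<subseteq> \<Omega>"
    using assms(1) by (simp add: closure_minimal compact_imp_closed)
  then have "cball w (dist w y) \<subseteq> \<Omega>" using pos by simp
  then show thesis using that y pos by blast
qed

text \<open>The largest ball in \<open>\<Omega>\<close> around \<open>z\<close> has radius exactly \<open>t\<close>: with more room, a neighbourhood of \<open>z\<close>
  would belong to the inner parallel set.\<close>

lemma frontier_inner_parallel_touches:
  fixes \<Omega> :: "'a::euclidean_space set"
  assumes "compact \<Omega>" "t > 0" "z \<in> frontier (inner_parallel \<Omega> t)"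
  obtains y where "y \<in> frontier \<Omega>" "dist z y = t" "cball z t \<subseteq> \<Omega>"
proof -
  have "z \<in> inner_parallel \<Omega> t"
    using assms(3) frontier_subset_closed[OF compact_imp_closed[OF compact_inner_parallel[OF assms(1)]]] by blast
  then have zt: "cball z t \<subseteq> \<Omega>" using inner_parallel_iff_cball_subset[OF assms(1)] assms(2) by simp
  then have "z \<in> interior \<Omega>" using assms(2) mem_interior_cball by blast
  then obtain y where y: "y \<in> frontier \<Omega>" "cball z (dist z y) \<subseteq> \<Omega>"
    using largest_ball_touches_frontier[OF assms(1)] by metis
  have "\<not> dist z y < t"
  proof
    assume "dist z y < t"
    moreover have "ball z t \<subseteq> interior \<Omega>"
      using zt ball_subset_cball by (intro interior_maximal) auto
    ultimately show False using y(1) by (auto simp: frontier_def)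
  qed
  moreover have "\<not> t < dist z y"
  proof
    assume lt: "t < dist z y"
    have "x \<in> inner_parallel \<Omega> t" if "x \<in> ball z (dist z y - t)" for x
    proof -
      have "cball x t \<subseteq> cball z (dist z y)"
        using that by (simp add: cball_subset_cball_iff dist_commute)
      then show ?thesis using y(2) inner_parallel_iff_cball_subset[OF assms(1)] assms(2) by simp
    qed
    then have "z \<in> interior (inner_parallel \<Omega> t)"
      unfolding mem_interior using lt by (intro exI[of _ "dist z y - t"]) auto
    then show False using assms(3) by (simp add: frontier_def)
  qed
  ultimately show thesis using that[OF y(1)] zt by simp
qed

text \<open>Join an interior point \<open>p\<close> to \<open>z\<close> and let \<open>e\<close> be the point where the segment leaves \<open>\<Omega>\<close>. Let \<open>w\<close> be
  a point of the segment slightly before \<open>e\<close>. The largest ball around \<open>w\<close> is small, and it touches the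
  frontier at a regular point. The distance to the supporting hyperplane at that point is an affine
  function of the position along the segment. At \<open>p\<close> it is bounded away from zero, at \<open>w\<close> it is
  small, and \<open>w\<close> stays away from \<open>z\<close>; hence it is negative at \<open>z\<close>.\<close>

lemma regular_normal_separates:
  fixes \<Omega> :: "'a::euclidean_space set"
  assumes \<Omega>: "convex_domain \<Omega>" and z: "z \<notin> \<Omega>"
  obtains u where "u \<in> regular_normals \<Omega>" "support_function \<Omega> u < z \<bullet> u"
proof -
  have c: "compact \<Omega>" "closed \<Omega>" "convex \<Omega>"
    using \<Omega> by (auto simp: convex_domain_def compact_imp_closed)
  obtain p where p: "p \<in> interior \<Omega>" using \<Omega> by (auto simp: convex_domain_def)
  then obtain \<rho>0 where \<rho>0: "\<rho>0 > 0" "cball p \<rho>0 \<subseteq> \<Omega>" using mem_interior_cball by blast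
  have "p \<in> \<Omega>" using p interior_subset by blast
  have "closed_segment p z \<inter> frontier \<Omega> \<noteq> {}"
    using \<open>p \<in> \<Omega>\<close> z by (intro connected_Int_frontier) (auto simp: disjoint_iff)
  then obtain e where e: "e \<in> closed_segment p z" "e \<in> frontier \<Omega>" by blast
  obtain \<mu> where \<mu>: "0 \<le> \<mu>" "\<mu> \<le> 1" "e = p + \<mu> *\<^sub>R (z - p)"
    using e(1) by (auto simp: in_segment algebra_simps)
  have "e \<in> \<Omega>" using e(2) frontier_subset_closed[OF c(2)] by blast
  then have "\<mu> < 1" using \<mu> z by (cases "\<mu> = 1") auto
  have "e \<noteq> p" using e(2) p by (auto simp: frontier_def)
  define d where "d = norm (e - p)"
  define g where "g = (1 - \<mu>) * \<rho>0"
  have d: "d > 0" using \<open>e \<noteq> p\<close> by (simp add: d_def)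
  have g: "g > 0" using \<open>\<mu> < 1\<close> \<rho>0 by (simp add: g_def)
  \<comment> \<open>The ball around \<open>w\<close> will have radius at most \<open>\<epsilon> * d\<close>; any radius below \<open>g\<close> makes the
    affine function negative at \<open>z\<close>.\<close>
  define \<epsilon> where "\<epsilon> = min 1 (g / (2 * d))"
  have \<epsilon>: "0 < \<epsilon>" "\<epsilon> \<le> 1" using d g by (auto simp: \<epsilon>_def)
  have "\<epsilon> \<le> g / (2 * d)" by (simp add: \<epsilon>_def)
  then have "\<epsilon> * d \<le> g / 2" using d by (simp add: field_simps)
  define w where "w = e - \<epsilon> *\<^sub>R (e - p)"
  have "w \<in> interior \<Omega>"
    unfolding w_def by (rule mem_interior_convex_shrink[OF c(3) p \<open>e \<in> \<Omega>\<close> \<epsilon>])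
  then obtain y where y: "y \<in> frontier \<Omega>" "dist w y > 0" "cball w (dist w y) \<subseteq> \<Omega>"
      "\<And>z. z \<in> frontier \<Omega> \<Longrightarrow> dist w y \<le> dist w z"
    using largest_ball_touches_frontier[OF c(1)] by metis
  define \<rho> where "\<rho> = dist w y"
  have "\<rho> \<le> \<epsilon> * d" using y(4)[OF e(2)] \<epsilon> by (simp add: \<rho>_def w_def d_def dist_norm)
  then have \<rho>: "\<rho> < g" using \<open>\<epsilon> * d \<le> g / 2\<close> g by linarith
  define u where "u = (1 / \<rho>) *\<^sub>R (y - w)"
  have u: "norm u = 1" "support_function \<Omega> u = y \<bullet> u" "y = w + \<rho> *\<^sub>R u" "u \<in> regular_normals \<Omega>"
    using touching_ball_regular_point[OF \<Omega> y(3,2,1) refl] unfolding u_def \<rho>_def by auto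
  define h where "h = support_function \<Omega> u"
  define l where "l = (1 - \<epsilon>) * \<mu>"
  have l: "0 \<le> l" "l \<le> \<mu>" using \<epsilon> \<mu>(1) mult_right_mono[of "1 - \<epsilon>" 1 \<mu>] by (auto simp: l_def)
  have "h = w \<bullet> u + \<rho>" unfolding h_def u(2) using u(1) by (subst u(3)) (simp add: inner_add_left norm_eq_1)
  moreover have weq: "w = p + l *\<^sub>R (z - p)" by (simp add: w_def \<mu>(3) l_def algebra_simps)
  have "w \<bullet> u = (1 - l) * (p \<bullet> u) + l * (z \<bullet> u)"
    unfolding weq by (simp add: inner_add_left inner_diff_left algebra_simps)
  moreover have "(1 - l) * (p \<bullet> u) \<le> (1 - l) * (h - \<rho>0)"
    using cball_support_function_le[OF c(1) \<rho>0(2) _ u(1)] \<rho>0(1) l \<mu>(2)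
    by (intro mult_left_mono) (auto simp: h_def)
  moreover have "g \<le> (1 - l) * \<rho>0" unfolding g_def using l \<rho>0(1) by (intro mult_right_mono) auto
  ultimately have "0 < l * (z \<bullet> u - h)" using \<rho> by (simp add: algebra_simps)
  then have "h < z \<bullet> u" using l(1) by (simp add: zero_less_mult_iff)
  then show thesis using that[OF u(4)] by (simp add: h_def)
qed

lemma convex_domain_eq_regular_halfspaces:
  assumes "convex_domain \<Omega>"
  shows "x \<in> \<Omega> \<longleftrightarrow> (\<forall>u\<in>regular_normals \<Omega>. x \<bullet> u \<le> support_function \<Omega> u)"
  using regular_normal_separates[OF assms, of x] support_function_upper[of \<Omega> x] assms
  unfolding convex_domain_def by (meson not_le)

text \<open>Let \<open>x\<close> be a regular point with normal \<open>u\<close>. Its homothetic image \<open>z\<close> is a boundary point of the inner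
  parallel set, so \<open>\<Omega>\<close> has a supporting hyperplane at distance \<open>t\<close> from \<open>z\<close>, with normal \<open>v\<close>
  say. The parallel hyperplane through \<open>z\<close> supports the inner parallel set; scaling back, \<open>v\<close> is normal
  to \<open>\<Omega>\<close> at \<open>x\<close>, and regularity forces \<open>v = u\<close>. Now compare the heights of \<open>x\<close> and \<open>z\<close> in direction
  \<open>u\<close>: they differ by \<open>t\<close>, and \<open>z\<close> arises from \<open>x\<close> by the homothety with ratio \<open>1 - t / r\<close>.\<close>

lemma support_function_if_inner_parallel_homothet:
  fixes \<Omega> :: "'a::euclidean_space set"
  assumes \<Omega>: "convex_domain \<Omega>" and t: "0 < t" "t < r"
    and eq: "inner_parallel \<Omega> t = homothet x0 (1 - t / r) ` \<Omega>"
    and u: "u \<in> regular_normals \<Omega>"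
  shows "support_function \<Omega> u = x0 \<bullet> u + r"
proof -
  have c: "compact \<Omega>" "closed \<Omega>" using \<Omega> by (auto simp: convex_domain_def compact_imp_closed)
  define s where "s = 1 - t / r"
  have s: "s > 0" "(1 - s) * r = t" "1 - s > 0" using t by (auto simp: s_def)
  obtain x where x: "regular_point \<Omega> x" "x \<bullet> u = support_function \<Omega> u" and u1: "norm u = 1"
    using u by (auto simp: regular_normals_def)
  have xf: "x \<in> frontier \<Omega>" using x(1) by (simp add: regular_point_def)
  then have "x \<in> \<Omega>" using frontier_subset_closed[OF c(2)] by blast
  define z where "z = homothet x0 s x"
  have "z \<in> frontier (inner_parallel \<Omega> t)"
    unfolding eq s_def[symmetric] frontier_homothet_image[OF s(1)] z_def using xf by blast
  then obtain y where y: "y \<in> frontier \<Omega>" "dist z y = t" "cball z t \<subseteq> \<Omega>"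
    using frontier_inner_parallel_touches[OF c(1) t(1)] by metis
  define v where "v = (1 / t) *\<^sub>R (y - z)"
  have v: "norm v = 1" "support_function \<Omega> v = y \<bullet> v" "y = z + t *\<^sub>R v"
    using touching_ball_regular_point[OF \<Omega> y(3) t(1) y(1,2)] unfolding v_def by auto
  have hv: "support_function \<Omega> v = z \<bullet> v + t"
    unfolding v(2) using v(1) by (subst v(3)) (simp add: inner_add_left norm_eq_1)
  have "x' \<bullet> v \<le> x \<bullet> v" if "x' \<in> \<Omega>" for x'
  proof -
    have "homothet x0 s x' \<in> inner_parallel \<Omega> t" unfolding eq s_def using that by blast
    then have "cball (homothet x0 s x') t \<subseteq> \<Omega>"
      using inner_parallel_iff_cball_subset[OF c(1)] t(1) by simp
    then have "homothet x0 s x' \<bullet> v + t \<le> z \<bullet> v + t"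
      using cball_support_function_le[OF c(1) _ _ v(1)] t(1) hv by fastforce
    then have "s * (x' \<bullet> v) \<le> s * (x \<bullet> v)"
      by (simp add: z_def homothet_def inner_add_left inner_diff_left algebra_simps)
    then show ?thesis using s(1) by simp
  qed
  then have "support_function \<Omega> v = x \<bullet> v" by (rule support_function_eqI[OF \<open>x \<in> \<Omega>\<close>])
  then have "v = u" using x u1 v(1) by (auto simp: regular_point_def)
  then have "x \<bullet> u = z \<bullet> u + t" using hv x(2) by simp
  then have "(1 - s) * (x \<bullet> u - x0 \<bullet> u) = (1 - s) * r"
    unfolding s(2) by (simp add: z_def homothet_def inner_add_left inner_diff_left algebra_simps)
  then show ?thesis using s(3) x(2) by simp
qed

section \<open>Homothety to the form body\<close>

lemma mem_scaled_form_body: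
  assumes "l > 0"
  shows "x \<in> (\<lambda>x. x0 + l *\<^sub>R x) ` form_body \<Omega> \<longleftrightarrow> (\<forall>u\<in>regular_normals \<Omega>. (x - x0) \<bullet> u \<le> l)"
proof
  assume "x \<in> (\<lambda>x. x0 + l *\<^sub>R x) ` form_body \<Omega>"
  then show "\<forall>u\<in>regular_normals \<Omega>. (x - x0) \<bullet> u \<le> l"
    using assms by (auto simp: form_body_def)
next
  assume *: "\<forall>u\<in>regular_normals \<Omega>. (x - x0) \<bullet> u \<le> l"
  show "x \<in> (\<lambda>x. x0 + l *\<^sub>R x) ` form_body \<Omega>"
  proof (rule image_eqI)
    show "x = x0 + l *\<^sub>R ((1 / l) *\<^sub>R (x - x0))" using assms by simp
    show "(1 / l) *\<^sub>R (x - x0) \<in> form_body \<Omega>"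
      using * assms by (auto simp: form_body_def pos_divide_le_eq)
  qed
qed

lemma homothetic_if_inner_parallel_homothet:
  fixes \<Omega> :: "'a::euclidean_space set"
  assumes "convex_domain \<Omega>" "0 < t" "t < r" "inner_parallel \<Omega> t = homothet x0 (1 - t / r) ` \<Omega>"
  shows "homothetic_to \<Omega> (form_body \<Omega>)"
proof -
  have "r > 0" using assms by simp
  have "\<Omega> = (\<lambda>x. x0 + r *\<^sub>R x) ` form_body \<Omega>"
  proof (rule set_eqI)
    fix x
    show "x \<in> \<Omega> \<longleftrightarrow> x \<in> (\<lambda>x. x0 + r *\<^sub>R x) ` form_body \<Omega>"
      unfolding mem_scaled_form_body[OF \<open>r > 0\<close>] convex_domain_eq_regular_halfspaces[OF assms(1), of x]
      using support_function_if_inner_parallel_homothet[OF assms] by (auto simp: inner_diff_left)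
  qed
  then show ?thesis using \<open>r > 0\<close> unfolding homothetic_to_def by blast
qed

text \<open>Next, \<open>\<Omega>\<close> is an intersection of half-spaces whose bounding hyperplanes are all at distance \<open>l\<close>
  from \<open>x0\<close>. Removing a layer of thickness \<open>t\<close> moves each hyperplane inwards by \<open>t\<close>, so the inner
  parallel sets are homothetic to \<open>\<Omega>\<close> as long as \<open>t < l\<close>.\<close>

context
  fixes \<Omega> U :: "'a::euclidean_space set" and x0 :: 'a and l :: real
  assumes compact: "compact \<Omega>" and l: "l > 0" and unit: "\<And>u. u \<in> U \<Longrightarrow> norm u = 1"
    and mem: "\<And>x. x \<in> \<Omega> \<longleftrightarrow> (\<forall>u\<in>U. (x - x0) \<bullet> u \<le> l)"
begin

lemma cball_subset_circumscribed_iff: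
  assumes "t \<ge> 0"
  shows "cball x t \<subseteq> \<Omega> \<longleftrightarrow> (\<forall>u\<in>U. (x - x0) \<bullet> u \<le> l - t)"
proof
  assume sub: "cball x t \<subseteq> \<Omega>"
  show "\<forall>u\<in>U. (x - x0) \<bullet> u \<le> l - t"
  proof
    fix u assume u: "u \<in> U"
    have "x + t *\<^sub>R u \<in> \<Omega>" using sub assms unit[OF u] by (auto simp: subset_iff dist_norm)
    then show "(x - x0) \<bullet> u \<le> l - t"
      using mem u unit[OF u] by (force simp: inner_add_left inner_diff_left norm_eq_1)
  qed
next
  assume *: "\<forall>u\<in>U. (x - x0) \<bullet> u \<le> l - t"
  show "cball x t \<subseteq> \<Omega>"
  proof
    fix y assume y: "y \<in> cball x t"
    have "(y - x0) \<bullet> u \<le> l" if "u \<in> U" for u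
    proof -
      have "(y - x) \<bullet> u \<le> norm (y - x)" using norm_cauchy_schwarz[of "y - x" u] unit[OF that] by simp
      also have "\<dots> \<le> t" using y by (simp add: dist_norm norm_minus_commute)
      finally show ?thesis using *[rule_format, OF that] by (simp add: inner_diff_left)
    qed
    then show "y \<in> \<Omega>" using mem by blast
  qed
qed

text \<open>Otherwise the ray from \<open>x0\<close> through \<open>x\<close> would lie in the bounded set \<open>\<Omega>\<close>.\<close>

lemma circumscribed_cone_trivial:
  assumes "\<forall>u\<in>U. (x - x0) \<bullet> u \<le> 0"
  shows "x = x0"
proof (rule ccontr)
  assume "x \<noteq> x0"
  then obtain s where s: "s \<ge> 0" "x0 + s *\<^sub>R (x - x0) \<notin> \<Omega>"
    using bounded_ray_exits[OF compact_imp_bounded[OF compact], of "x - x0" x0] by auto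
  have "s * ((x - x0) \<bullet> u) \<le> l" if "u \<in> U" for u
    using mult_nonneg_nonpos[OF s(1), of "(x - x0) \<bullet> u"] assms that l by force
  then show False using s(2) unfolding mem by simp
qed

lemma circumscribed_normals_nonempty: "U \<noteq> {}"
proof
  assume "U = {}"
  then have "x = x0" for x using circumscribed_cone_trivial[of x] by simp
  then show False using not_bounded_UNIV[where 'a='a] by (metis UNIV_eq_I bounded_insert bounded_empty insertI1)
qed

lemma inradius_circumscribed: "inradius \<Omega> = l"
proof (rule inradius_eqI)
  show "cball x0 l \<subseteq> \<Omega>" using cball_subset_circumscribed_iff[of l x0] l by simp
  fix y \<rho> assume \<rho>: "0 \<le> \<rho>" "cball y \<rho> \<subseteq> \<Omega>"
  then have *: "\<forall>u\<in>U. (y - x0) \<bullet> u \<le> l - \<rho>" using cball_subset_circumscribed_iff by blast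
  show "\<rho> \<le> l"
  proof (rule ccontr)
    assume "\<not> \<rho> \<le> l"
    then have "y = x0" using * by (intro circumscribed_cone_trivial) force
    then show False using * \<open>\<not> \<rho> \<le> l\<close> circumscribed_normals_nonempty by auto
  qed
qed (use l in simp)

lemma inner_parallel_circumscribed:
  assumes "0 \<le> t" "t < l"
  shows "inner_parallel \<Omega> t = homothet x0 (1 - t / l) ` \<Omega>"
proof (rule set_eqI)
  fix x
  define s where "s = 1 - t / l"
  have s: "s > 0" "l - t = s * l" using assms l by (auto simp: s_def field_simps)
  have "x \<in> homothet x0 s ` \<Omega> \<longleftrightarrow> x0 + (1 / s) *\<^sub>R (x - x0) \<in> \<Omega>"
  proof
    assume "x \<in> homothet x0 s ` \<Omega>"
    then show "x0 + (1 / s) *\<^sub>R (x - x0) \<in> \<Omega>" using s(1) by (auto simp: homothet_def)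
  next
    assume *: "x0 + (1 / s) *\<^sub>R (x - x0) \<in> \<Omega>"
    show "x \<in> homothet x0 s ` \<Omega>"
      by (rule image_eqI[OF _ *]) (use s(1) in \<open>simp add: homothet_def\<close>)
  qed
  also have "\<dots> \<longleftrightarrow> (\<forall>u\<in>U. (x - x0) \<bullet> u \<le> l - t)"
    unfolding mem s(2) using s(1) by (simp add: pos_divide_le_eq mult.commute)
  also have "\<dots> \<longleftrightarrow> x \<in> inner_parallel \<Omega> t"
    using cball_subset_circumscribed_iff inner_parallel_iff_cball_subset[OF compact] assms(1) by simp
  finally show "x \<in> inner_parallel \<Omega> t \<longleftrightarrow> x \<in> homothet x0 (1 - t / l) ` \<Omega>" by (simp add: s_def)
qed

lemma inner_parallel_circumscribed_degenerate:
  assumes "l \<le> t"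
  shows "inner_parallel \<Omega> t \<subseteq> {x0}"
proof
  fix x assume "x \<in> inner_parallel \<Omega> t"
  then have "\<forall>u\<in>U. (x - x0) \<bullet> u \<le> l - t"
    using cball_subset_circumscribed_iff inner_parallel_iff_cball_subset[OF compact] assms l by simp
  then have "\<forall>u\<in>U. (x - x0) \<bullet> u \<le> 0" using assms by force
  then show "x \<in> {x0}" using circumscribed_cone_trivial by simp
qed

end

section \<open>The perimeter of inner parallel sets\<close>

theorem theorem1p2:
  fixes \<Omega> :: "'a::euclidean_space set" and r :: real
  assumes "DIM('a) \<ge> 2"
    and "convex_domain \<Omega>"
    and "r = inradius \<Omega>"
  shows "(\<forall>t\<ge>0. perimeter (inner_parallel \<Omega> t)
                  \<ge> ennreal (pos_part (1 - t / r) ^ (DIM('a) - 1)) * perimeter \<Omega>)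
       \<and> ((\<exists>t\<in>{0<..<r}. perimeter (inner_parallel \<Omega> t)
                  = ennreal (pos_part (1 - t / r) ^ (DIM('a) - 1)) * perimeter \<Omega>)
            \<longleftrightarrow> homothetic_to \<Omega> (form_body \<Omega>))
       \<and> (homothetic_to \<Omega> (form_body \<Omega>) \<longrightarrow>
            (\<forall>t\<ge>0. perimeter (inner_parallel \<Omega> t)
                  = ennreal (pos_part (1 - t / r) ^ (DIM('a) - 1)) * perimeter \<Omega>))"
proof -
  have c: "compact \<Omega>" "convex \<Omega>" using assms(2) by (auto simp: convex_domain_def)
  obtain x0 where r: "r > 0" and x0: "cball x0 r \<subseteq> \<Omega>"
    using inball_exists[OF assms(2)] assms(3) by metis
  have pp: "pos_part (1 - t / r) = (if t < r then 1 - t / r else 0)" for t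
    using r by (auto simp: pos_part_def)
  have k: "DIM('a) - 1 > 0" using assms(1) by simp
  have per: "perimeter (homothet x (1 - t / r) ` \<Omega>) = ennreal (pos_part (1 - t / r) ^ (DIM('a) - 1)) * perimeter \<Omega>"
    if "t < r" for t x
    using perimeter_homothet_image[of "1 - t / r" x \<Omega>] that r by (simp add: pp)
  have sub: "homothet x0 (1 - t / r) ` \<Omega> \<subseteq> inner_parallel \<Omega> t"
    and dom: "convex_domain (homothet x0 (1 - t / r) ` \<Omega>)" "convex_domain (inner_parallel \<Omega> t)"
    if "0 < t" "t < r" for t
  proof -
    show s: "homothet x0 (1 - t / r) ` \<Omega> \<subseteq> inner_parallel \<Omega> t"
      using homothet_image_subset_inner_parallel[OF c x0] that by simp
    show d: "convex_domain (homothet x0 (1 - t / r) ` \<Omega>)"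
      using convex_domain_homothet_image[OF _ assms(2)] that r by simp
    show "convex_domain (inner_parallel \<Omega> t)"
      using interior_mono[OF s] d compact_inner_parallel[OF c(1)] convex_inner_parallel[OF c] that
      by (auto simp: convex_domain_def)
  qed
  have ineq: "perimeter (inner_parallel \<Omega> t) \<ge> ennreal (pos_part (1 - t / r) ^ (DIM('a) - 1)) * perimeter \<Omega>"
    if t0: "t \<ge> 0" for t
  proof -
    consider "t = 0" | "0 < t" "t < r" | "t \<ge> r" using t0 by linarith
    then show ?thesis
    proof cases
      case 1
      then show ?thesis using pp[of 0] r by (simp add: inner_parallel_0)
    next
      case 2
      then show ?thesis using perimeter_mono[OF dom sub] per by simp
    next
      case 3
      then show ?thesis using k by (simp add: pp zero_power)
    qed
  qed
  have eq_imp: "homothetic_to \<Omega> (form_body \<Omega>)"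
    if t: "0 < t" "t < r"
      and eq: "perimeter (inner_parallel \<Omega> t) = ennreal (pos_part (1 - t / r) ^ (DIM('a) - 1)) * perimeter \<Omega>" for t
  proof -
    have "\<not> homothet x0 (1 - t / r) ` \<Omega> \<subset> inner_parallel \<Omega> t"
      using perimeter_strict_mono[OF assms(1) dom[OF t]] eq per[OF t(2), of x0] by auto
    then have "inner_parallel \<Omega> t = homothet x0 (1 - t / r) ` \<Omega>" using sub[OF t] by blast
    then show ?thesis by (rule homothetic_if_inner_parallel_homothet[OF assms(2) t])
  qed
  have hom: "perimeter (inner_parallel \<Omega> t) = ennreal (pos_part (1 - t / r) ^ (DIM('a) - 1)) * perimeter \<Omega>"
    if "homothetic_to \<Omega> (form_body \<Omega>)" "t \<ge> 0" for t
  proof -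
    from that(1) obtain x1 l where l: "l > 0" "\<Omega> = (\<lambda>x. x1 + l *\<^sub>R x) ` form_body \<Omega>"
      unfolding homothetic_to_def by blast
    have unit: "\<And>u. u \<in> regular_normals \<Omega> \<Longrightarrow> norm u = 1" by (simp add: regular_normals_def)
    have mem: "\<And>x. x \<in> \<Omega> \<longleftrightarrow> (\<forall>u\<in>regular_normals \<Omega>. (x - x1) \<bullet> u \<le> l)"
      using mem_scaled_form_body[OF l(1), of _ x1 \<Omega>] l(2) by simp
    note circ = c(1) l(1) unit mem
    have "l = r" using inradius_circumscribed[OF circ] assms(3) by simp
    show ?thesis
    proof (cases "t < r")
      case True
      then show ?thesis
        using inner_parallel_circumscribed[OF circ that(2)] per[OF True] \<open>l = r\<close> by simp
    next
      case False
      have "inner_parallel \<Omega> t \<subseteq> {x1}"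
        using inner_parallel_circumscribed_degenerate[OF circ] False \<open>l = r\<close> by simp
      then have "frontier (inner_parallel \<Omega> t) \<subseteq> {x1}"
        using frontier_subset_closed[OF compact_imp_closed[OF compact_inner_parallel[OF c(1)]]] by blast
      then have "perimeter (inner_parallel \<Omega> t) \<le> hausdorff_measure (DIM('a) - 1) {x1}"
        unfolding perimeter_def by (rule hausdorff_measure_mono)
      then show ?thesis using False k by (simp add: pp hausdorff_measure_singleton zero_power)
    qed
  qed
  show ?thesis
  proof (intro conjI impI iffI)
    assume "homothetic_to \<Omega> (form_body \<Omega>)"
    then show "\<exists>t\<in>{0<..<r}. perimeter (inner_parallel \<Omega> t)
        = ennreal (pos_part (1 - t / r) ^ (DIM('a) - 1)) * perimeter \<Omega>"
      using hom[of "r / 2"] r by (intro bexI[of _ "r / 2"]) auto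
  qed (use ineq eq_imp hom in auto)
qed

end
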